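(* Let $\overline{\Omega}=\Omega\cup\partial\Omega$, let $f\in C^6(\overline{\Omega})$, let $u\in C^8(\overline{\Omega})$ be a solution of the Dirichlet problem $$\partial_x^2u+\partial_y^2u+K^2u=f\ \text{ in }\Omega,\qquad u=\Phi\ \text{ on }\partial\Omega,$$ and let $U_{i,j}$ be the solution of the standard sixth-order scheme $$\left(\delta_x^2+\delta_y^2+\frac{h^2}{6}\left(1+\frac{K^2h^2}{30}\right)\delta_x^2\delta_y^2\right)U_{i,j}+\left(1-\frac{K^2h^2}{12}\left(1-\frac{K^2h^2}{30}\right)\right)K^2U_{i,j}$$ $$=\left(1-\frac{K^2h^2}{12}\left(1-\frac{K^2h^2}{30}\right)\right)f_{i,j}+\frac{h^2}{12}\left(1-\frac{K^2h^2}{30}\right)(\partial_x^2+\partial_y^2)f_{i,j}+\frac{h^4}{360}(\delta_x^2\partial_x^2+\delta_y^2\partial_y^2)f_{i,j}+\frac{h^4}{90}\delta_x^2\delta_y^2f_{i,j}$$ for $1\le i,j\le N-1$, with $U_{i,j}=\Phi(x_i,y_j)$ on $\partial\Omega_h$. Then for sufficiently small $Kh$ (i.e. there is $\varepsilon>0$ such that the following holds whenever $0<Kh<\varepsilon$), where $K$ is the wave number and $h$ the grid size, $$\|\mathbf{u}-\mathbf{U}\|_\infty\le C_3^{(1)}h^6+C_4^{(1)}\left(K^2\|\partial^6u\|_{\infty,\Omega_h^0}+\|\partial^8u\|_{\infty,\Omega_h^0}\right)h^6$$ for some constants $C_3^{(1)},C_4^{(1)}$ independent of $h$.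
   Context: $\Omega=[a,b]\times[c,d]$ is a rectangle and $K$ is a constant. The grid $\Omega_h$ consists of the points $(x_i,y_j)$, $x_i=a+ih$, $y_j=c+jh$, $0\le i,j\le N$ (with $x_N=b$, $y_N=d$); $\Omega_h^0$ is the set of interior points ($1\le i,j\le N-1$) and $\partial\Omega_h$ the boundary grid points. $\delta_x^2\varphi_{i,j}=\frac{\varphi_{i-1,j}-2\varphi_{i,j}+\varphi_{i+1,j}}{h^2}$, $\delta_y^2\varphi_{i,j}=\frac{\varphi_{i,j-1}-2\varphi_{i,j}+\varphi_{i,j+1}}{h^2}$, and $\delta_x^2\delta_y^2$ is their composition. Norms: $\|\mathbf{u}-\mathbf{U}\|_\infty=\max_{0\le i,j\le N}|u(x_i,y_j)-U_{i,j}|$ and $$\|\partial^pu\|_{\infty,\Omega_h^0}=\sup\left\{\left|\frac{\partial^pu}{\partial x^{r_1}\partial y^{r_2}}(x,y)\right|:(x,y)\in\Omega_h^0,\ r_1+r_2=p,\ r_1,r_2\in\{0,\dots,p\}\right\}.$$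
   Formalization: The formal statement also assumes that u is the only C^8 solution of the Dirichlet problem; without this the claim fails, e.g. on [0,π]² with K=√2, f=Φ=0, u=sin x sin y, where U=0 solves the scheme for every h. *)

theory Defs
  imports "HOL-Analysis.Analysis"
begin

(* Partial derivatives relative to S. Taking the derivative within the slice of S makes them
   the ordinary partial derivatives at interior points of a closed rectangle and the one-sided
   ones at its edges. *)

definition dx_on :: "(real \<times> real) set \<Rightarrow> (real \<times> real \<Rightarrow> real) \<Rightarrow> real \<times> real \<Rightarrow> real" where
  "dx_on S g = (\<lambda>(x, y). vector_derivative (\<lambda>s. g (s, y)) (at x within {s. (s, y) \<in> S}))"

definition dy_on :: "(real \<times> real) set \<Rightarrow> (real \<times> real \<Rightarrow> real) \<Rightarrow> real \<times> real \<Rightarrow> real" where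
  "dy_on S g = (\<lambda>(x, y). vector_derivative (\<lambda>t. g (x, t)) (at y within {t. (x, t) \<in> S}))"

definition laplace_on :: "(real \<times> real) set \<Rightarrow> (real \<times> real \<Rightarrow> real) \<Rightarrow> real \<times> real \<Rightarrow> real" where
  "laplace_on S g = (\<lambda>p. (dx_on S ^^ 2) g p + (dy_on S ^^ 2) g p)"

(* C^k on S: all iterated partial derivatives of order at most k, in any order of
   differentiation, exist on S (one-sided at the edges) and are continuous on S. *)

fun Ck_on :: "nat \<Rightarrow> (real \<times> real) set \<Rightarrow> (real \<times> real \<Rightarrow> real) \<Rightarrow> bool" where
  "Ck_on 0 S g \<longleftrightarrow> continuous_on S g"
| "Ck_on (Suc k) S g \<longleftrightarrow> continuous_on S g \<and>
     (\<forall>(x, y) \<in> S. (\<lambda>s. g (s, y)) differentiable (at x within {s. (s, y) \<in> S}) \<and>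
                    (\<lambda>t. g (x, t)) differentiable (at y within {t. (x, t) \<in> S})) \<and>
     Ck_on k S (dx_on S g) \<and> Ck_on k S (dy_on S g)"

definition dirichlet_solution ::
  "(real \<times> real) set \<Rightarrow> real \<Rightarrow> (real \<times> real \<Rightarrow> real) \<Rightarrow> (real \<times> real \<Rightarrow> real) \<Rightarrow>
   (real \<times> real \<Rightarrow> real) \<Rightarrow> bool" where
  "dirichlet_solution S K f \<Phi> u \<longleftrightarrow>
     (\<forall>p \<in> interior S. laplace_on S u p + K\<^sup>2 * u p = f p) \<and> (\<forall>p \<in> frontier S. u p = \<Phi> p)"

definition grid_pt :: "real \<Rightarrow> real \<Rightarrow> real \<Rightarrow> nat \<Rightarrow> nat \<Rightarrow> real \<times> real" where
  "grid_pt a c h i j = (a + real i * h, c + real j * h)"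

definition grid_interior :: "real \<Rightarrow> real \<Rightarrow> real \<Rightarrow> nat \<Rightarrow> (real \<times> real) set" where
  "grid_interior a c h N = {grid_pt a c h i j | i j. 0 < i \<and> i < N \<and> 0 < j \<and> j < N}"

(* Second differences of grid functions; they are used only at indices i, j > 0, where the
   subtraction on nat does not truncate. *)

definition \<delta>x2 :: "real \<Rightarrow> (nat \<Rightarrow> nat \<Rightarrow> real) \<Rightarrow> nat \<Rightarrow> nat \<Rightarrow> real" where
  "\<delta>x2 h \<phi> i j = (\<phi> (i - 1) j - 2 * \<phi> i j + \<phi> (i + 1) j) / h\<^sup>2"

definition \<delta>y2 :: "real \<Rightarrow> (nat \<Rightarrow> nat \<Rightarrow> real) \<Rightarrow> nat \<Rightarrow> nat \<Rightarrow> real" where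
  "\<delta>y2 h \<phi> i j = (\<phi> i (j - 1) - 2 * \<phi> i j + \<phi> i (j + 1)) / h\<^sup>2"

definition on_grid ::
  "real \<Rightarrow> real \<Rightarrow> real \<Rightarrow> (real \<times> real \<Rightarrow> real) \<Rightarrow> nat \<Rightarrow> nat \<Rightarrow> real" where
  "on_grid a c h g = (\<lambda>i j. g (grid_pt a c h i j))"

definition scheme_lhs :: "real \<Rightarrow> real \<Rightarrow> (nat \<Rightarrow> nat \<Rightarrow> real) \<Rightarrow> nat \<Rightarrow> nat \<Rightarrow> real" where
  "scheme_lhs h K U i j =
     \<delta>x2 h U i j + \<delta>y2 h U i j
     + h^2 / 6 * (1 + K^2 * h^2 / 30) * \<delta>x2 h (\<delta>y2 h U) i j
     + (1 - K^2 * h^2 / 12 * (1 - K^2 * h^2 / 30)) * K^2 * U i j"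

definition scheme_rhs ::
  "real \<Rightarrow> real \<Rightarrow> (real \<times> real) set \<Rightarrow> real \<Rightarrow> real \<Rightarrow> (real \<times> real \<Rightarrow> real) \<Rightarrow> nat \<Rightarrow> nat \<Rightarrow> real" where
  "scheme_rhs a c S h K f i j =
     (1 - K^2 * h^2 / 12 * (1 - K^2 * h^2 / 30)) * on_grid a c h f i j
     + h^2 / 12 * (1 - K^2 * h^2 / 30) * on_grid a c h (laplace_on S f) i j
     + h^4 / 360 * (\<delta>x2 h (on_grid a c h ((dx_on S ^^ 2) f)) i j
                    + \<delta>y2 h (on_grid a c h ((dy_on S ^^ 2) f)) i j)
     + h^4 / 90 * \<delta>x2 h (\<delta>y2 h (on_grid a c h f)) i j"

definition scheme_solution ::
  "real \<Rightarrow> real \<Rightarrow> (real \<times> real) set \<Rightarrow> real \<Rightarrow> nat \<Rightarrow> real \<Rightarrow> (real \<times> real \<Rightarrow> real) \<Rightarrow>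
   (real \<times> real \<Rightarrow> real) \<Rightarrow> (nat \<Rightarrow> nat \<Rightarrow> real) \<Rightarrow> bool" where
  "scheme_solution a c S h N K f \<Phi> U \<longleftrightarrow>
     (\<forall>i j. 0 < i \<and> i < N \<and> 0 < j \<and> j < N \<longrightarrow> scheme_lhs h K U i j = scheme_rhs a c S h K f i j) \<and>
     (\<forall>i\<le>N. \<forall>j\<le>N. i \<in> {0, N} \<or> j \<in> {0, N} \<longrightarrow> U i j = \<Phi> (grid_pt a c h i j))"

definition grid_error ::
  "real \<Rightarrow> real \<Rightarrow> real \<Rightarrow> nat \<Rightarrow> (real \<times> real \<Rightarrow> real) \<Rightarrow> (nat \<Rightarrow> nat \<Rightarrow> real) \<Rightarrow> real" where
  "grid_error a c h N u U =
     Max ((\<lambda>(i, j). \<bar>u (grid_pt a c h i j) - U i j\<bar>) ` ({0..N} \<times> {0..N}))"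

definition deriv_norm ::
  "(real \<times> real) set \<Rightarrow> (real \<times> real) set \<Rightarrow> nat \<Rightarrow> (real \<times> real \<Rightarrow> real) \<Rightarrow> real" where
  "deriv_norm S G p u =
     Sup {\<bar>(dx_on S ^^ r1) ((dy_on S ^^ r2) u) q\<bar> | q r1 r2. q \<in> G \<and> r1 + r2 = p}"

end

theory Submission
  imports Defs
begin

text \<open>
The estimate is consistency of order six combined with a stability bound that is uniform in the
step size.

Consistency. Write \<open>X\<close> and \<open>Y\<close> for the second derivatives in \<open>x\<close> and \<open>y\<close>, and \<open>\<kappa> = K\<^sup>2\<close>.
Taylor's formula gives \<open>\<delta>x2 = X + h^2/12 X^2 + h^4/360 X^3 + O(h^6)\<close>, similarly for \<open>\<delta>y2\<close>, and
mixed differences are treated by iterating this. On substituting \<open>f = (X + Y + \<kappa>) u\<close>, all terms of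
order below \<open>h^6\<close> in the difference of the two sides of the scheme cancel
(\<open>consistency_identity\<close>). The Taylor remainders involve derivatives of \<open>u\<close> up to order eight
at points between the grid points, so they are bounded by maxima over the closed rectangle
(\<open>scheme_consistency\<close>). These maxima depend on \<open>u\<close> but not on \<open>h\<close>; they go into the constant
\<open>C3\<close>, and \<open>C4 = 0\<close> is then a valid choice.

Stability. The number \<open>K\<^sup>2\<close> may exceed the smallest Dirichlet eigenvalue of the negative Laplacian, so
there is no maximum principle, and stability has to come from the uniqueness of \<open>u\<close>. Products
of discrete sine modes diagonalise the difference operator; its eigenvalues are the negatives of
\<open>scheme_symbol\<close>. For a fixed pair of frequencies \<open>m, n\<close> the symbol tends to
\<open>\<pi>\<^sup>2 (m\<^sup>2 + n\<^sup>2) / L\<^sup>2 - K\<^sup>2\<close> as \<open>h\<close> tends to \<open>0\<close>, where \<open>L\<close> is the side length. This limit is not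
zero, because otherwise the corresponding product of sines could be added to \<open>u\<close>
(\<open>unique_imp_nonresonant\<close>). When \<open>m\<^sup>2 + n\<^sup>2\<close> is at least \<open>K\<^sup>2 L\<^sup>2\<close>, an elementary estimate bounds
the symbol from below for all small \<open>h\<close> at once; only finitely many pairs are left. Together this
gives a lower bound \<open>\<gamma> (m\<^sup>2 + n\<^sup>2)\<close> for the modulus of the symbol (\<open>scheme_symbol_coercive\<close>).
Parseval's identity and the Cauchy-Schwarz inequality convert it into a bound in the maximum
norm, since the double series of \<open>1 / (m\<^sup>2 + n\<^sup>2)\<^sup>2\<close> converges (\<open>discrete_stability\<close>).

The two steps \<open>h\<close> and the two numbers of intervals are equal, so a grid exists only if the rectangle is a
square, and \<open>K * h > 0\<close> forces \<open>K > 0\<close>; otherwise there is nothing to prove.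
\<close>

section \<open>Partial derivatives on a rectangle\<close>

abbreviation (input) rect :: "real \<Rightarrow> real \<Rightarrow> real \<Rightarrow> real \<Rightarrow> (real \<times> real) set" where
  "rect a b c d \<equiv> {a..b} \<times> {c..d}"

text \<open>
On a nondegenerate closed interval a derivative relative to the interval is unique, even at an
end point; this is what lets the one-sided derivatives at the edges be computed by the usual rules.
\<close>

lemma dx_on_eqI:
  assumes "a < b" "x \<in> {a..b}" "y \<in> {c..d}"
    and "((\<lambda>s. g (s, y)) has_real_derivative D) (at x within {a..b})"
  shows "dx_on (rect a b c d) g (x, y) = D"
proof -
  have "{s. (s, y) \<in> rect a b c d} = {a..b}" using assms by auto
  then show ?thesis
    unfolding dx_on_def using assms
    by (simp add: has_real_derivative_iff_has_vector_derivative vector_derivative_within_closed_interval)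
qed

lemma dy_on_eqI:
  assumes "c < d" "x \<in> {a..b}" "y \<in> {c..d}"
    and "((\<lambda>t. g (x, t)) has_real_derivative D) (at y within {c..d})"
  shows "dy_on (rect a b c d) g (x, y) = D"
proof -
  have "{t. (x, t) \<in> rect a b c d} = {c..d}" using assms by auto
  then show ?thesis
    unfolding dy_on_def using assms
    by (simp add: has_real_derivative_iff_has_vector_derivative vector_derivative_within_closed_interval)
qed

lemma Ck_on_Suc_dx:
  assumes "Ck_on (Suc k) (rect a b c d) g" "a < b" "x \<in> {a..b}" "y \<in> {c..d}"
  shows "((\<lambda>s. g (s, y)) has_real_derivative dx_on (rect a b c d) g (x, y)) (at x within {a..b})"
proof -
  have "{s. (s, y) \<in> rect a b c d} = {a..b}" using assms by auto
  then have "(\<lambda>s. g (s, y)) differentiable (at x within {a..b})"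
    using assms by auto
  then obtain D where D: "((\<lambda>s. g (s, y)) has_real_derivative D) (at x within {a..b})"
    using real_differentiableE by blast
  with dx_on_eqI[OF assms(2-4) D] show ?thesis by simp
qed

lemma Ck_on_Suc_dy:
  assumes "Ck_on (Suc k) (rect a b c d) g" "c < d" "x \<in> {a..b}" "y \<in> {c..d}"
  shows "((\<lambda>t. g (x, t)) has_real_derivative dy_on (rect a b c d) g (x, y)) (at y within {c..d})"
proof -
  have "{t. (x, t) \<in> rect a b c d} = {c..d}" using assms by auto
  then have "(\<lambda>t. g (x, t)) differentiable (at y within {c..d})"
    using assms by auto
  then obtain D where D: "((\<lambda>t. g (x, t)) has_real_derivative D) (at y within {c..d})"
    using real_differentiableE by blast
  with dy_on_eqI[OF assms(2-4) D] show ?thesis by simp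
qed

lemma dx_on_cong:
  assumes "\<And>p. p \<in> S \<Longrightarrow> g p = g' p" "p \<in> S"
  shows "dx_on S g p = dx_on S g' p"
proof (cases p)
  case (Pair x y)
  have "vector_derivative (\<lambda>s. g (s, y)) (at x within {s. (s, y) \<in> S})
      = vector_derivative (\<lambda>s. g' (s, y)) (at x within {s. (s, y) \<in> S})"
    by (rule vector_derivative_cong_eq)
      (use assms Pair in \<open>auto simp: eventually_at_filter\<close>)
  then show ?thesis by (simp add: dx_on_def Pair)
qed

lemma dy_on_cong:
  assumes "\<And>p. p \<in> S \<Longrightarrow> g p = g' p" "p \<in> S"
  shows "dy_on S g p = dy_on S g' p"
proof (cases p)
  case (Pair x y)
  have "vector_derivative (\<lambda>t. g (x, t)) (at y within {t. (x, t) \<in> S})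
      = vector_derivative (\<lambda>t. g' (x, t)) (at y within {t. (x, t) \<in> S})"
    by (rule vector_derivative_cong_eq)
      (use assms Pair in \<open>auto simp: eventually_at_filter\<close>)
  then show ?thesis by (simp add: dy_on_def Pair)
qed

lemma Ck_on_cong:
  "Ck_on k S g \<Longrightarrow> (\<And>p. p \<in> S \<Longrightarrow> g p = g' p) \<Longrightarrow> Ck_on k S g'"
proof (induction k arbitrary: g g')
  case 0
  then show ?case by (auto cong: continuous_on_cong)
next
  case (Suc k)
  have cont: "continuous_on S g'"
    using Suc.prems by (metis Ck_on.simps(2) continuous_on_cong)
  have 1: "(\<lambda>s. g' (s, y)) differentiable (at x within {s. (s, y) \<in> S})" if "(x, y) \<in> S" for x y
    by (rule differentiable_transform_within[where f = "\<lambda>s. g (s, y)" and d = 1])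
       (use Suc.prems that in auto)
  have 2: "(\<lambda>t. g' (x, t)) differentiable (at y within {t. (x, t) \<in> S})" if "(x, y) \<in> S" for x y
    by (rule differentiable_transform_within[where f = "\<lambda>t. g (x, t)" and d = 1])
       (use Suc.prems that in auto)
  show ?case
    using cont 1 2 Suc.IH[of "dx_on S g" "dx_on S g'"] Suc.IH[of "dy_on S g" "dy_on S g'"]
      Suc.prems dx_on_cong[of S g g'] dy_on_cong[of S g g'] by auto
qed

lemma Ck_on_pred: "Ck_on (Suc k) S g \<Longrightarrow> Ck_on k S g"
proof (induction k arbitrary: g)
  case (Suc k)
  then have "Ck_on (Suc k) S (dx_on S g)" "Ck_on (Suc k) S (dy_on S g)"
    by (simp_all only: Ck_on.simps(2)[of "Suc k"])
  from this[THEN Suc.IH] Suc.prems show ?case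
    unfolding Ck_on.simps(2)[of _ S g] by blast
qed simp

lemma Ck_on_mono: "k \<le> l \<Longrightarrow> Ck_on l S g \<Longrightarrow> Ck_on k S g"
  by (induction rule: dec_induct) (auto dest: Ck_on_pred simp del: Ck_on.simps)

lemma Ck_on_continuous: "Ck_on k S g \<Longrightarrow> continuous_on S g"
  by (cases k) auto

lemma Ck_on_funpow_dx: "Ck_on (r + k) S g \<Longrightarrow> Ck_on k S ((dx_on S ^^ r) g)"
proof (induction r arbitrary: g)
  case (Suc r)
  then have "Ck_on (r + k) S (dx_on S g)" by simp
  from Suc.IH[OF this] show ?case by (simp only: funpow_Suc_right o_apply)
qed simp

lemma Ck_on_funpow_dy: "Ck_on (r + k) S g \<Longrightarrow> Ck_on k S ((dy_on S ^^ r) g)"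
proof (induction r arbitrary: g)
  case (Suc r)
  then have "Ck_on (r + k) S (dy_on S g)" by simp
  from Suc.IH[OF this] show ?case by (simp only: funpow_Suc_right o_apply)
qed simp

lemma dx_on_add:
  assumes "a < b" "Ck_on (Suc k) (rect a b c d) g" "Ck_on (Suc k) (rect a b c d) g'" "p \<in> rect a b c d"
  shows "dx_on (rect a b c d) (\<lambda>p. g p + g' p) p = dx_on (rect a b c d) g p + dx_on (rect a b c d) g' p"
  using assms
  by (cases p) (auto intro!: dx_on_eqI DERIV_add Ck_on_Suc_dx simp del: Ck_on.simps)

lemma dy_on_add:
  assumes "c < d" "Ck_on (Suc k) (rect a b c d) g" "Ck_on (Suc k) (rect a b c d) g'" "p \<in> rect a b c d"
  shows "dy_on (rect a b c d) (\<lambda>p. g p + g' p) p = dy_on (rect a b c d) g p + dy_on (rect a b c d) g' p"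
  using assms
  by (cases p) (auto intro!: dy_on_eqI DERIV_add Ck_on_Suc_dy simp del: Ck_on.simps)

lemma Ck_on_add:
  assumes "a < b" "c < d"
  shows "Ck_on k (rect a b c d) g \<Longrightarrow> Ck_on k (rect a b c d) g' \<Longrightarrow>
    Ck_on k (rect a b c d) (\<lambda>p. g p + g' p)"
proof (induction k arbitrary: g g')
  case 0
  then show ?case by (auto intro: continuous_on_add)
next
  case (Suc k)
  let ?S = "rect a b c d"
  note dx = dx_on_add[OF assms(1) Suc.prems] and dy = dy_on_add[OF assms(2) Suc.prems]
  have "Ck_on k ?S (dx_on ?S (\<lambda>p. g p + g' p))" "Ck_on k ?S (dy_on ?S (\<lambda>p. g p + g' p))"
    using Ck_on_cong[OF Suc.IH[of "dx_on ?S g" "dx_on ?S g'"] dx[symmetric]]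
      Ck_on_cong[OF Suc.IH[of "dy_on ?S g" "dy_on ?S g'"] dy[symmetric]] Suc.prems by simp_all
  moreover have "continuous_on ?S (\<lambda>p. g p + g' p)"
    using Suc.prems by (intro continuous_on_add) (auto dest: Ck_on_continuous simp del: Ck_on.simps)
  ultimately show ?case
    using Suc.prems by (simp add: case_prod_beta differentiable_add)
qed

text \<open>
The second difference over the corners of a rectangle, evaluated by two applications of the mean
value theorem. The order of differentiation is the order in which the two variables are used.
\<close>

lemma mixed_partial_mvt:
  assumes C: "\<And>x y. x \<in> {x1..x2} \<Longrightarrow> y \<in> {y1..y2} \<Longrightarrow>
      ((\<lambda>s. g (s, y)) has_real_derivative gx (x, y)) (at x within {x1..x2})"
    and C': "\<And>x y. x \<in> {x1..x2} \<Longrightarrow> y \<in> {y1..y2} \<Longrightarrow>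
      ((\<lambda>t. gx (x, t)) has_real_derivative gxy (x, y)) (at y within {y1..y2})"
    and "x1 < x2" "y1 < (y2::real)"
  shows "\<exists>x\<in>{x1..x2}. \<exists>y\<in>{y1..y2}.
    g (x2, y2) - g (x2, y1) - g (x1, y2) + g (x1, y1) = (x2 - x1) * (y2 - y1) * gxy (x, y)"
proof -
  let ?\<phi> = "\<lambda>s. g (s, y2) - g (s, y1)"
  have "\<exists>x\<in>{x1<..<x2}. ?\<phi> x2 - ?\<phi> x1 = (\<lambda>x z. z * (gx (x, y2) - gx (x, y1))) x (x2 - x1)"
  proof (rule mvt_simple[OF \<open>x1 < x2\<close>])
    fix x assume "x1 \<le> x" "x \<le> x2"
    with C[of x y2] C[of x y1] \<open>y1 < y2\<close>
    have "(?\<phi> has_real_derivative (gx (x, y2) - gx (x, y1))) (at x within {x1..x2})"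
      by (auto intro!: DERIV_diff)
    then show "(?\<phi> has_derivative (\<lambda>z. z * (gx (x, y2) - gx (x, y1)))) (at x within {x1..x2})"
      by (simp add: has_field_derivative_def mult_commute_abs)
  qed
  then obtain x where x: "x \<in> {x1<..<x2}" and
    1: "?\<phi> x2 - ?\<phi> x1 = (x2 - x1) * (gx (x, y2) - gx (x, y1))" by auto
  have "\<exists>y\<in>{y1<..<y2}. gx (x, y2) - gx (x, y1) = (\<lambda>y z. z * gxy (x, y)) y (y2 - y1)"
  proof (rule mvt_simple[OF \<open>y1 < y2\<close>])
    fix y assume "y1 \<le> y" "y \<le> y2"
    with C'[of x y] x show "((\<lambda>y. gx (x, y)) has_derivative (\<lambda>z. z * gxy (x, y))) (at y within {y1..y2})"
      by (auto simp add: has_field_derivative_def mult_commute_abs)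
  qed
  then obtain y where y: "y \<in> {y1<..<y2}" and
    2: "gx (x, y2) - gx (x, y1) = (y2 - y1) * gxy (x, y)" by auto
  from 1 2 x y show ?thesis
    by (intro bexI[of _ x] bexI[of _ y]) (auto simp: algebra_simps)
qed

text \<open>
The classical argument for the symmetry of second derivatives: on every small rectangle near
\<open>p\<close> the corner difference is a value of one mixed derivative and also a value of the other.
The small rectangle only has to lie in the given one and near \<open>p\<close>, so the argument covers points
on the edges.
\<close>

lemma dx_dy_commute:
  assumes "a < b" "c < d" and g: "Ck_on (Suc (Suc k)) (rect a b c d) g" and p: "p \<in> rect a b c d"
  shows "dy_on (rect a b c d) (dx_on (rect a b c d) g) p = dx_on (rect a b c d) (dy_on (rect a b c d) g) p"
proof (rule ccontr)
  let ?S = "rect a b c d"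
  define A where "A = dy_on ?S (dx_on ?S g)"
  define B where "B = dx_on ?S (dy_on ?S g)"
  assume "dy_on ?S (dx_on ?S g) p \<noteq> dx_on ?S (dy_on ?S g) p"
  then have ne: "\<bar>A p - B p\<bar> > 0" by (simp add: A_def B_def)
  obtain x y where pxy: "p = (x, y)" by (cases p)
  with p have xy: "x \<in> {a..b}" "y \<in> {c..d}" by auto
  have gx: "Ck_on (Suc k) ?S (dx_on ?S g)" and gy: "Ck_on (Suc k) ?S (dy_on ?S g)"
    using g by auto
  have "continuous_on ?S A" "continuous_on ?S B"
    unfolding A_def B_def using gx gy by (auto intro: Ck_on_continuous)
  then obtain \<delta>1 \<delta>2 where \<delta>: "\<delta>1 > 0" "\<delta>2 > 0"
    and A: "\<And>q. q \<in> ?S \<Longrightarrow> dist q p < \<delta>1 \<Longrightarrow> dist (A q) (A p) < \<bar>A p - B p\<bar> / 2"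
    and B: "\<And>q. q \<in> ?S \<Longrightarrow> dist q p < \<delta>2 \<Longrightarrow> dist (B q) (B p) < \<bar>A p - B p\<bar> / 2"
    using p ne unfolding continuous_on_iff by (metis half_gt_zero)
  define \<delta> where "\<delta> = min \<delta>1 \<delta>2 / 3"
  have \<delta>0: "\<delta> > 0" using \<delta> by (simp add: \<delta>_def)
  \<comment> \<open>at an edge or corner the small rectangle is cut off, but it keeps a nonempty interior\<close>
  define x1 x2 y1 y2 where "x1 = max a (x - \<delta>)" and "x2 = min b (x + \<delta>)"
    and "y1 = max c (y - \<delta>)" and "y2 = min d (y + \<delta>)"
  have sub: "{x1..x2} \<subseteq> {a..b}" "{y1..y2} \<subseteq> {c..d}" and lt: "x1 < x2" "y1 < y2"
    using xy \<delta>0 assms(1,2) by (auto simp: x1_def x2_def y1_def y2_def)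
  have near: "dist (s, t) p < min \<delta>1 \<delta>2" if "s \<in> {x1..x2}" "t \<in> {y1..y2}" for s t
  proof -
    have "dist s x \<le> \<delta>" "dist t y \<le> \<delta>"
      using that by (auto simp: x1_def x2_def y1_def y2_def dist_real_def)
    then have "dist (s, t) p \<le> \<delta> + \<delta>"
      unfolding pxy dist_Pair_Pair by (smt (verit) sqrt_sum_squares_le_sum zero_le_dist)
    with \<delta>0 show ?thesis unfolding \<delta>_def by linarith
  qed
  have "\<exists>s\<in>{x1..x2}. \<exists>t\<in>{y1..y2}.
    g (x2, y2) - g (x2, y1) - g (x1, y2) + g (x1, y1) = (x2 - x1) * (y2 - y1) * A (s, t)"
    unfolding A_def
    by (rule mixed_partial_mvt[where gx = "dx_on ?S g"])
      (use lt sub assms(1,2) in \<open>auto intro!: DERIV_subset[OF Ck_on_Suc_dx[OF g]] DERIV_subset[OF Ck_on_Suc_dy[OF gx]]\<close>)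
  then obtain s t where st: "s \<in> {x1..x2}" "t \<in> {y1..y2}"
    and 1: "g (x2, y2) - g (x2, y1) - g (x1, y2) + g (x1, y1) = (x2 - x1) * (y2 - y1) * A (s, t)" by blast
  \<comment> \<open>the same mean value argument with the two coordinates exchanged\<close>
  have "\<exists>t\<in>{y1..y2}. \<exists>s\<in>{x1..x2}.
    (\<lambda>(t, s). g (s, t)) (y2, x2) - (\<lambda>(t, s). g (s, t)) (y2, x1) - (\<lambda>(t, s). g (s, t)) (y1, x2) + (\<lambda>(t, s). g (s, t)) (y1, x1)
    = (y2 - y1) * (x2 - x1) * (\<lambda>(t, s). B (s, t)) (t, s)"
    unfolding B_def
    by (rule mixed_partial_mvt[where gx = "\<lambda>(t, s). dy_on ?S g (s, t)"])
      (use lt sub assms(1,2) in \<open>auto intro!: DERIV_subset[OF Ck_on_Suc_dy[OF g]] DERIV_subset[OF Ck_on_Suc_dx[OF gy]]\<close>)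
  then obtain s' t' where st': "s' \<in> {x1..x2}" "t' \<in> {y1..y2}"
    and 2: "g (x2, y2) - g (x2, y1) - g (x1, y2) + g (x1, y1) = (x2 - x1) * (y2 - y1) * B (s', t')"
    by (auto simp: algebra_simps)
  have "A (s, t) = B (s', t')" using 1 2 lt by auto
  moreover have "dist (A (s, t)) (A p) < \<bar>A p - B p\<bar> / 2"
    using A near[OF st] st sub by auto
  moreover have "dist (B (s', t')) (B p) < \<bar>A p - B p\<bar> / 2"
    using B near[OF st'] st' sub by auto
  ultimately show False by (auto simp: dist_real_def abs_if split: if_splits)
qed

lemma dy_funpow_dx_commute:
  assumes "a < b" "c < d"
  shows "Ck_on (Suc r) (rect a b c d) g \<Longrightarrow> p \<in> rect a b c d \<Longrightarrow>
    dy_on (rect a b c d) ((dx_on (rect a b c d) ^^ r) g) p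
    = (dx_on (rect a b c d) ^^ r) (dy_on (rect a b c d) g) p"
proof (induction r arbitrary: p)
  case (Suc r)
  let ?S = "rect a b c d"
  have "Ck_on (Suc (Suc 0)) ?S ((dx_on ?S ^^ r) g)"
    using Ck_on_funpow_dx[of r "Suc (Suc 0)" ?S g] Suc.prems by simp
  from dx_dy_commute[OF assms this Suc.prems(2)]
  have "dy_on ?S ((dx_on ?S ^^ Suc r) g) p = dx_on ?S (dy_on ?S ((dx_on ?S ^^ r) g)) p" by simp
  also have "\<dots> = dx_on ?S ((dx_on ?S ^^ r) (dy_on ?S g)) p"
    by (rule dx_on_cong) (use Suc Ck_on_pred in blast)+
  finally show ?case by simp
qed simp

text \<open>
The derivatives of a function as a doubly indexed family: \<open>G r s\<close> stands for \<open>r\<close> derivatives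
in \<open>x\<close> and \<open>s\<close> derivatives in \<open>y\<close>. The order of differentiation is no longer visible, so linear
combinations of such families can be formed and differentiated index by index.
\<close>

definition jet_on ::
  "nat \<Rightarrow> real \<Rightarrow> real \<Rightarrow> real \<Rightarrow> real \<Rightarrow> (nat \<Rightarrow> nat \<Rightarrow> real \<times> real \<Rightarrow> real) \<Rightarrow> bool" where
  "jet_on k a b c d G \<longleftrightarrow>
     (\<forall>r s. r + s \<le> k \<longrightarrow> continuous_on (rect a b c d) (G r s)) \<and>
     (\<forall>r s. r + s < k \<longrightarrow> (\<forall>x\<in>{a..b}. \<forall>y\<in>{c..d}.
        ((\<lambda>\<xi>. G r s (\<xi>, y)) has_real_derivative G (Suc r) s (x, y)) (at x within {a..b}) \<and>
        ((\<lambda>\<eta>. G r s (x, \<eta>)) has_real_derivative G r (Suc s) (x, y)) (at y within {c..d})))"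

lemma jet_on_dx:
  "jet_on k a b c d G \<Longrightarrow> r + s < k \<Longrightarrow> x \<in> {a..b} \<Longrightarrow> y \<in> {c..d} \<Longrightarrow>
    ((\<lambda>\<xi>. G r s (\<xi>, y)) has_real_derivative G (Suc r) s (x, y)) (at x within {a..b})"
  and jet_on_dy:
  "jet_on k a b c d G \<Longrightarrow> r + s < k \<Longrightarrow> x \<in> {a..b} \<Longrightarrow> y \<in> {c..d} \<Longrightarrow>
    ((\<lambda>\<eta>. G r s (x, \<eta>)) has_real_derivative G r (Suc s) (x, y)) (at y within {c..d})"
  unfolding jet_on_def by blast+

text \<open>
The only point is that a \<open>y\<close>-derivative, taken last, may be moved inside all the \<open>x\<close>-derivatives.
\<close>

lemma Ck_on_jet:
  assumes "a < b" "c < d" and g: "Ck_on k (rect a b c d) g"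
  shows "jet_on k a b c d (\<lambda>r s. (dx_on (rect a b c d) ^^ r) ((dy_on (rect a b c d) ^^ s) g))"
  unfolding jet_on_def
proof (intro conjI allI impI ballI)
  let ?S = "rect a b c d"
  let ?G = "\<lambda>r s. (dx_on ?S ^^ r) ((dy_on ?S ^^ s) g)"
  have smooth: "Ck_on m ?S (?G r s)" if "r + s + m \<le> k" for r s m
    using that g Ck_on_mono[of "s + (r + m)" k ?S g]
    by (intro Ck_on_funpow_dx Ck_on_funpow_dy) (auto simp: algebra_simps)
  fix r s
  {
    assume "r + s \<le> k"
    then show "continuous_on ?S (?G r s)" using smooth[of r s 0] by simp
  }
  fix x y assume rs: "r + s < k" and xy: "x \<in> {a..b}" "y \<in> {c..d}"
  have C1: "Ck_on (Suc 0) ?S (?G r s)" using smooth[of r s "Suc 0"] rs by simp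
  show "((\<lambda>\<xi>. ?G r s (\<xi>, y)) has_real_derivative ?G (Suc r) s (x, y)) (at x within {a..b})"
    using Ck_on_Suc_dx[OF C1 assms(1) xy] by simp
  have "Ck_on (Suc r) ?S ((dy_on ?S ^^ s) g)"
    using rs g Ck_on_mono[of "s + Suc r" k ?S g] by (intro Ck_on_funpow_dy) auto
  then have "dy_on ?S (?G r s) (x, y) = ?G r (Suc s) (x, y)"
    using dy_funpow_dx_commute[OF assms(1,2), where p = "(x, y)"] xy by simp
  then show "((\<lambda>\<eta>. ?G r s (x, \<eta>)) has_real_derivative ?G r (Suc s) (x, y)) (at y within {c..d})"
    using Ck_on_Suc_dy[OF C1 assms(2) xy] by simp
qed

lemma jet_on_bounded:
  assumes "jet_on k a b c d G"
  shows "\<exists>M\<ge>0. \<forall>r s. r + s \<le> k \<longrightarrow> (\<forall>p\<in>rect a b c d. \<bar>G r s p\<bar> \<le> M)"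
proof -
  let ?S = "rect a b c d"
  have "\<exists>B. \<forall>p\<in>?S. \<bar>G r s p\<bar> \<le> B" if "r + s \<le> k" for r s
  proof -
    have "bounded (G r s ` ?S)"
      using assms that unfolding jet_on_def
      by (intro compact_imp_bounded compact_continuous_image compact_Times) auto
    then show ?thesis by (auto simp: bounded_iff)
  qed
  then obtain B where B: "\<And>r s p. r + s \<le> k \<Longrightarrow> p \<in> ?S \<Longrightarrow> \<bar>G r s p\<bar> \<le> B r s"
    by metis
  have "\<bar>G r s p\<bar> \<le> (\<Sum>r\<le>k. \<Sum>s\<le>k. \<bar>B r s\<bar>)" if "r + s \<le> k" "p \<in> ?S" for r s p
  proof -
    have "\<bar>G r s p\<bar> \<le> \<bar>B r s\<bar>" using B[OF that] by linarith
    also have "\<dots> \<le> (\<Sum>s\<le>k. \<bar>B r s\<bar>)"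
      by (rule member_le_sum) (use that in auto)
    also have "\<dots> \<le> (\<Sum>r\<le>k. \<Sum>s\<le>k. \<bar>B r s\<bar>)"
      by (rule member_le_sum[where f = "\<lambda>r. \<Sum>s\<le>k. \<bar>B r s\<bar>"]) (use that in \<open>auto intro: sum_nonneg\<close>)
    finally show ?thesis .
  qed
  then show ?thesis by (intro exI[of _ "\<Sum>r\<le>k. \<Sum>s\<le>k. \<bar>B r s\<bar>"]) (auto intro!: sum_nonneg)
qed

section \<open>Second difference quotients of smooth functions\<close>

definition second_quotient :: "real \<Rightarrow> (real \<Rightarrow> real) \<Rightarrow> real \<Rightarrow> real" where
  "second_quotient h \<phi> x = (\<phi> (x - h) - 2 * \<phi> x + \<phi> (x + h)) / h\<^sup>2"

text \<open>
Taylor's formula at \<open>x + h\<close> and \<open>x - h\<close> added up; the odd powers of \<open>h\<close> in the sum cancel. The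
derivatives are relative to the interval, since \<open>x + h\<close> or \<open>x - h\<close> may be one of its end points.
\<close>

lemma second_difference_taylor:
  fixes g :: "nat \<Rightarrow> real \<Rightarrow> real"
  assumes deriv: "\<And>i t. t \<in> {l..u} \<Longrightarrow> i \<le> n \<Longrightarrow>
      (g i has_real_derivative g (Suc i) t) (at t within {l..u})"
    and bound: "\<And>t. t \<in> {l..u} \<Longrightarrow> \<bar>g (Suc n) t\<bar> \<le> M"
    and mem: "x \<in> {l..u}" "x - h \<in> {l..u}" "x + h \<in> {l..u}"
  shows "\<bar>g 0 (x - h) + g 0 (x + h) - (\<Sum>i\<le>n. g i x * (h ^ i + (-h) ^ i) / fact i)\<bar>
    \<le> 2 * M * \<bar>h\<bar> ^ Suc n / fact n"
proof -
  have T: "\<bar>g 0 z - (\<Sum>i\<le>n. g i x * (z - x) ^ i / fact i)\<bar> \<le> M * \<bar>z - x\<bar> ^ Suc n / fact n"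
    if "z \<in> {l..u}" for z
    using field_Taylor[of "{l..u}" n g M x z] deriv bound mem(1) that by simp
  have "(\<Sum>i\<le>n. g i x * (h ^ i + (-h) ^ i) / fact i)
      = (\<Sum>i\<le>n. g i x * h ^ i / fact i) + (\<Sum>i\<le>n. g i x * (-h) ^ i / fact i)"
    by (simp add: sum.distrib[symmetric] distrib_left add_divide_distrib)
  moreover have "\<bar>g 0 (x - h) - (\<Sum>i\<le>n. g i x * (-h) ^ i / fact i)\<bar> \<le> M * \<bar>h\<bar> ^ Suc n / fact n"
    using T[OF mem(2)] by simp
  moreover have "\<bar>g 0 (x + h) - (\<Sum>i\<le>n. g i x * h ^ i / fact i)\<bar> \<le> M * \<bar>h\<bar> ^ Suc n / fact n"
    using T[OF mem(3)] by simp
  moreover have "2 * M * \<bar>h\<bar> ^ Suc n / fact n = M * \<bar>h\<bar> ^ Suc n / fact n + M * \<bar>h\<bar> ^ Suc n / fact n"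
    by simp
  ultimately show ?thesis by linarith
qed

text \<open>
Division by \<open>h\<^sup>2\<close> leaves remainders of orders zero, two, four and six in \<open>h\<close>. The coefficients
\<open>1/12\<close> and \<open>1/360\<close> are \<open>2/4!\<close> and \<open>2/6!\<close>. Each remainder uses only the derivative of
order two more, which decides how many derivatives of \<open>u\<close> and \<open>f\<close> the scheme consumes.
\<close>

lemma second_quotient_bounds:
  fixes g :: "nat \<Rightarrow> real \<Rightarrow> real"
  assumes h: "h > 0" and mem: "x \<in> {l..u}" "x - h \<in> {l..u}" "x + h \<in> {l..u}"
    and deriv: "\<And>i t. t \<in> {l..u} \<Longrightarrow> i \<le> n \<Longrightarrow>
      (g i has_real_derivative g (Suc i) t) (at t within {l..u})"
    and bound: "\<And>t. t \<in> {l..u} \<Longrightarrow> \<bar>g (Suc n) t\<bar> \<le> M"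
  shows "n = 1 \<Longrightarrow> \<bar>second_quotient h (g 0) x\<bar> \<le> 2 * M"
    and "n = 3 \<Longrightarrow> \<bar>second_quotient h (g 0) x - g 2 x\<bar> \<le> M * h\<^sup>2"
    and "n = 5 \<Longrightarrow> \<bar>second_quotient h (g 0) x - g 2 x - h\<^sup>2 / 12 * g 4 x\<bar> \<le> M * h ^ 4"
    and "n = 7 \<Longrightarrow> \<bar>second_quotient h (g 0) x - g 2 x - h\<^sup>2 / 12 * g 4 x - h ^ 4 / 360 * g 6 x\<bar> \<le> M * h ^ 6"
proof -
  have M: "M \<ge> 0" using bound[OF mem(1)] by linarith
  have T: "\<bar>g 0 (x - h) + g 0 (x + h) - (\<Sum>i\<le>n. g i x * (h ^ i + (-h) ^ i) / fact i)\<bar>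
      \<le> 2 * M * \<bar>h\<bar> ^ Suc n / fact n"
    by (rule second_difference_taylor[OF deriv bound mem])
  have h2: "h\<^sup>2 \<noteq> 0" using h by simp
  have div: "\<bar>E / h\<^sup>2\<bar> \<le> B" if "\<bar>E\<bar> \<le> B * h\<^sup>2" for E B
    using that h by (simp add: abs_divide pos_divide_le_eq)
  have shrink: "2 * M * h ^ k / fact j \<le> M * h ^ k" if "2 \<le> (fact j :: real)" for j k
  proof -
    have "2 * (M * h ^ k) \<le> fact j * (M * h ^ k)"
      using that M h by (intro mult_right_mono) auto
    then show ?thesis by (simp add: divide_le_eq mult_ac)
  qed
  {
    assume n: "n = 1"
    have "\<bar>(g 0 (x - h) - 2 * g 0 x + g 0 (x + h)) / h\<^sup>2\<bar> \<le> 2 * M"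
      using T h unfolding n by (intro div) (simp add: power2_eq_square algebra_simps)
    then show "\<bar>second_quotient h (g 0) x\<bar> \<le> 2 * M" by (simp add: second_quotient_def)
  next
    assume n: "n = 3"
    have "\<bar>(g 0 (x - h) - 2 * g 0 x + g 0 (x + h) - h\<^sup>2 * g 2 x) / h\<^sup>2\<bar> \<le> M * h\<^sup>2"
      using T h shrink[of 3 4] unfolding n
      by (intro div) (simp add: eval_nat_numeral algebra_simps)
    then show "\<bar>second_quotient h (g 0) x - g 2 x\<bar> \<le> M * h\<^sup>2"
      by (simp only: second_quotient_def diff_divide_distrib nonzero_mult_div_cancel_left[OF h2])
  next
    assume n: "n = 5"
    have "\<bar>(g 0 (x - h) - 2 * g 0 x + g 0 (x + h) - h\<^sup>2 * g 2 x - h\<^sup>2 * (h\<^sup>2 / 12 * g 4 x)) / h\<^sup>2\<bar>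
        \<le> M * h ^ 4"
      using T h shrink[of 5 6] unfolding n
      by (intro div) (simp add: eval_nat_numeral algebra_simps)
    then show "\<bar>second_quotient h (g 0) x - g 2 x - h\<^sup>2 / 12 * g 4 x\<bar> \<le> M * h ^ 4"
      by (simp only: second_quotient_def diff_divide_distrib nonzero_mult_div_cancel_left[OF h2])
  next
    assume n: "n = 7"
    have "\<bar>(g 0 (x - h) - 2 * g 0 x + g 0 (x + h) - h\<^sup>2 * g 2 x - h\<^sup>2 * (h\<^sup>2 / 12 * g 4 x)
        - h\<^sup>2 * (h ^ 4 / 360 * g 6 x)) / h\<^sup>2\<bar> \<le> M * h ^ 6"
      using T h shrink[of 7 8] unfolding n
      by (intro div) (simp add: eval_nat_numeral algebra_simps)
    then show "\<bar>second_quotient h (g 0) x - g 2 x - h\<^sup>2 / 12 * g 4 x - h ^ 4 / 360 * g 6 x\<bar> \<le> M * h ^ 6"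
      by (simp only: second_quotient_def diff_divide_distrib nonzero_mult_div_cancel_left[OF h2])
  }
qed

context
  fixes k :: nat and a b c d x y h M :: real and G :: "nat \<Rightarrow> nat \<Rightarrow> real \<times> real \<Rightarrow> real"
  assumes jet: "jet_on k a b c d G"
    and bound: "\<And>r s p. r + s \<le> k \<Longrightarrow> p \<in> rect a b c d \<Longrightarrow> \<bar>G r s p\<bar> \<le> M"
    and h: "h > 0"
    and x: "x \<in> {a..b}" "x - h \<in> {a..b}" "x + h \<in> {a..b}"
    and y: "y \<in> {c..d}" "y - h \<in> {c..d}" "y + h \<in> {c..d}"
begin

lemma jet_second_quotient_x:
  shows "r + s + 4 \<le> k \<Longrightarrow>
      \<bar>second_quotient h (\<lambda>\<xi>. G r s (\<xi>, y)) x - G (r + 2) s (x, y)\<bar> \<le> M * h\<^sup>2"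
    and "r + s + 6 \<le> k \<Longrightarrow>
      \<bar>second_quotient h (\<lambda>\<xi>. G r s (\<xi>, y)) x - G (r + 2) s (x, y) - h\<^sup>2 / 12 * G (r + 4) s (x, y)\<bar> \<le> M * h ^ 4"
    and "r + s + 8 \<le> k \<Longrightarrow>
      \<bar>second_quotient h (\<lambda>\<xi>. G r s (\<xi>, y)) x - G (r + 2) s (x, y) - h\<^sup>2 / 12 * G (r + 4) s (x, y)
        - h ^ 4 / 360 * G (r + 6) s (x, y)\<bar> \<le> M * h ^ 6"
  using second_quotient_bounds(2)[OF h x, of 3 "\<lambda>i \<xi>. G (r + i) s (\<xi>, y)" M]
    second_quotient_bounds(3)[OF h x, of 5 "\<lambda>i \<xi>. G (r + i) s (\<xi>, y)" M]
    second_quotient_bounds(4)[OF h x, of 7 "\<lambda>i \<xi>. G (r + i) s (\<xi>, y)" M]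
    jet_on_dx[OF jet _ _ y(1)] bound y(1) by simp_all

lemma jet_second_quotient_y:
  assumes \<xi>: "\<xi> \<in> {a..b}"
  shows "r + s + 4 \<le> k \<Longrightarrow>
      \<bar>second_quotient h (\<lambda>\<eta>. G r s (\<xi>, \<eta>)) y - G r (s + 2) (\<xi>, y)\<bar> \<le> M * h\<^sup>2"
    and "r + s + 6 \<le> k \<Longrightarrow>
      \<bar>second_quotient h (\<lambda>\<eta>. G r s (\<xi>, \<eta>)) y - G r (s + 2) (\<xi>, y) - h\<^sup>2 / 12 * G r (s + 4) (\<xi>, y)\<bar> \<le> M * h ^ 4"
    and "r + s + 8 \<le> k \<Longrightarrow>
      \<bar>second_quotient h (\<lambda>\<eta>. G r s (\<xi>, \<eta>)) y - G r (s + 2) (\<xi>, y) - h\<^sup>2 / 12 * G r (s + 4) (\<xi>, y)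
        - h ^ 4 / 360 * G r (s + 6) (\<xi>, y)\<bar> \<le> M * h ^ 6"
  using second_quotient_bounds(2)[OF h y, of 3 "\<lambda>i \<eta>. G r (s + i) (\<xi>, \<eta>)" M]
    second_quotient_bounds(3)[OF h y, of 5 "\<lambda>i \<eta>. G r (s + i) (\<xi>, \<eta>)" M]
    second_quotient_bounds(4)[OF h y, of 7 "\<lambda>i \<eta>. G r (s + i) (\<xi>, \<eta>)" M]
    jet_on_dy[OF jet _ \<xi>] bound \<xi> by simp_all

text \<open>
The mixed quotient is the quotient in \<open>x\<close> of the one in \<open>y\<close>. The remainder \<open>R 0\<close> of
the inner expansion is itself smooth in \<open>x\<close>, and its second \<open>x\<close>-derivative \<open>R 2\<close> is the remainder for
\<open>G 2 0\<close>; so the quotient of \<open>R 0\<close> loses no power of \<open>h\<close>, although it contains a division by \<open>h\<^sup>2\<close>.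
\<close>

lemma jet_second_quotient_xy_order2:
  assumes "6 \<le> k"
  shows "\<bar>second_quotient h (\<lambda>\<xi>. second_quotient h (\<lambda>\<eta>. G 0 0 (\<xi>, \<eta>)) y) x - G 2 2 (x, y)\<bar> \<le> 3 * M * h\<^sup>2"
proof -
  define R where "R = (\<lambda>r \<xi>. second_quotient h (\<lambda>\<eta>. G r 0 (\<xi>, \<eta>)) y - G r 2 (\<xi>, y))"
  have "(R r has_real_derivative R (Suc r) \<xi>) (at \<xi> within {a..b})" if "\<xi> \<in> {a..b}" "r \<le> 1" for r \<xi>
    unfolding R_def second_quotient_def
    by (intro DERIV_diff DERIV_add DERIV_cdivide DERIV_cmult jet_on_dx[OF jet]) (use that y assms in auto)
  moreover have "\<bar>R (Suc 1) \<xi>\<bar> \<le> M * h\<^sup>2" if "\<xi> \<in> {a..b}" for \<xi>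
    using jet_second_quotient_y(1)[OF that, of 2 0] assms by (simp add: R_def numeral_2_eq_2)
  ultimately have "\<bar>second_quotient h (R 0) x\<bar> \<le> 2 * (M * h\<^sup>2)"
    by (intro second_quotient_bounds(1)[OF h x, of 1]) auto
  moreover have "second_quotient h (R 0) x = second_quotient h (\<lambda>\<xi>. second_quotient h (\<lambda>\<eta>. G 0 0 (\<xi>, \<eta>)) y) x - second_quotient h (\<lambda>\<xi>. G 0 2 (\<xi>, y)) x"
    by (simp add: second_quotient_def[of h _ x] R_def diff_divide_distrib add_divide_distrib)
  moreover have "\<bar>second_quotient h (\<lambda>\<xi>. G 0 2 (\<xi>, y)) x - G 2 2 (x, y)\<bar> \<le> M * h\<^sup>2"
    using jet_second_quotient_x(1)[of 0 2] assms by (simp add: numeral_2_eq_2)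
  ultimately show ?thesis by linarith
qed

text \<open>
As before, with the inner expansion carried one term further.
\<close>

lemma jet_second_quotient_xy_order4:
  assumes "8 \<le> k"
  shows "\<bar>second_quotient h (\<lambda>\<xi>. second_quotient h (\<lambda>\<eta>. G 0 0 (\<xi>, \<eta>)) y) x
      - G 2 2 (x, y) - h\<^sup>2 / 12 * (G 4 2 (x, y) + G 2 4 (x, y))\<bar> \<le> 4 * M * h ^ 4"
proof -
  define R where "R = (\<lambda>r \<xi>. second_quotient h (\<lambda>\<eta>. G r 0 (\<xi>, \<eta>)) y - G r 2 (\<xi>, y) - h\<^sup>2 / 12 * G r 4 (\<xi>, y))"
  have M: "0 \<le> M" using bound[of 0 0 "(x, y)"] x y by auto
  have "(R r has_real_derivative R (Suc r) \<xi>) (at \<xi> within {a..b})" if "\<xi> \<in> {a..b}" "r \<le> 1" for r \<xi>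
    unfolding R_def second_quotient_def
    by (intro DERIV_diff DERIV_add DERIV_cdivide DERIV_cmult jet_on_dx[OF jet]) (use that y assms in auto)
  moreover have "\<bar>R (Suc 1) \<xi>\<bar> \<le> M * h ^ 4" if "\<xi> \<in> {a..b}" for \<xi>
    using jet_second_quotient_y(2)[OF that, of 2 0] assms by (simp add: R_def numeral_2_eq_2)
  ultimately have 1: "\<bar>second_quotient h (R 0) x\<bar> \<le> 2 * (M * h ^ 4)"
    by (intro second_quotient_bounds(1)[OF h x, of 1]) auto
  have 2: "second_quotient h (R 0) x = second_quotient h (\<lambda>\<xi>. second_quotient h (\<lambda>\<eta>. G 0 0 (\<xi>, \<eta>)) y) x
      - second_quotient h (\<lambda>\<xi>. G 0 2 (\<xi>, y)) x - h\<^sup>2 / 12 * second_quotient h (\<lambda>\<xi>. G 0 4 (\<xi>, y)) x"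
    by (simp add: second_quotient_def[of h _ x] R_def diff_divide_distrib add_divide_distrib algebra_simps)
  have 3: "\<bar>second_quotient h (\<lambda>\<xi>. G 0 2 (\<xi>, y)) x - G 2 2 (x, y) - h\<^sup>2 / 12 * G 4 2 (x, y)\<bar> \<le> M * h ^ 4"
    using jet_second_quotient_x(2)[of 0 2] assms by (simp del: add_2_eq_Suc')
  have "\<bar>second_quotient h (\<lambda>\<xi>. G 0 4 (\<xi>, y)) x - G 2 4 (x, y)\<bar> \<le> M * h\<^sup>2"
    using jet_second_quotient_x(1)[of 0 4] assms by (simp del: add_2_eq_Suc')
  then have "h\<^sup>2 / 12 * \<bar>second_quotient h (\<lambda>\<xi>. G 0 4 (\<xi>, y)) x - G 2 4 (x, y)\<bar> \<le> h\<^sup>2 / 12 * (M * h\<^sup>2)"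
    by (intro mult_left_mono) auto
  also have "\<dots> = M * h ^ 4 / 12" by (simp add: eval_nat_numeral)
  also have "\<dots> \<le> M * h ^ 4" using M h by simp
  finally have 4: "\<bar>h\<^sup>2 / 12 * (second_quotient h (\<lambda>\<xi>. G 0 4 (\<xi>, y)) x - G 2 4 (x, y))\<bar> \<le> M * h ^ 4"
    by (simp add: abs_mult)
  show ?thesis using 1 2 3 4 unfolding right_diff_distrib distrib_left by linarith
qed

end

section \<open>Consistency of the scheme\<close>

text \<open>
Here \<open>F\<close> is the family of derivatives of \<open>f = (X + Y + K\<^sup>2) u\<close>; the two orders that the
operator consumes are the difference between the smoothness of \<open>u\<close> and that of \<open>f\<close>.
\<close>

lemma helmholtz_jet:
  assumes jet: "jet_on (k + 2) a b c d G"
    and F: "F = (\<lambda>r s p. G (r + 2) s p + G r (s + 2) p + K\<^sup>2 * G r s p)"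
  shows "jet_on k a b c d F"
  unfolding jet_on_def
proof (intro conjI allI impI ballI)
  fix r s
  {
    assume "r + s \<le> k"
    with jet show "continuous_on (rect a b c d) (F r s)"
      unfolding F jet_on_def by (intro continuous_intros) auto
  }
  fix x y assume rs: "r + s < k" and xy: "x \<in> {a..b}" "y \<in> {c..d}"
  show "((\<lambda>\<xi>. F r s (\<xi>, y)) has_real_derivative F (Suc r) s (x, y)) (at x within {a..b})"
    using rs xy unfolding F add_Suc
    by (intro DERIV_add DERIV_cmult jet_on_dx[OF jet]) auto
  show "((\<lambda>\<eta>. F r s (x, \<eta>)) has_real_derivative F r (Suc s) (x, y)) (at y within {c..d})"
    using rs xy unfolding F add_Suc
    by (intro DERIV_add DERIV_cmult jet_on_dy[OF jet]) auto
qed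

text \<open>
The algebra behind the coefficients of the scheme, with \<open>H = h\<^sup>2\<close>. The variables \<open>gij\<close> stand for the
derivatives of \<open>u\<close> of orders \<open>i\<close> and \<open>j\<close>, and the \<open>ri\<close> for the remainders in the six expansions of
difference quotients. Everything up to \<open>H\<^sup>2\<close> that does not contain a remainder cancels; one term with
\<open>H ^ 3\<close> is left, from the product of the \<open>H\<^sup>2\<close> part of the mixed coefficient with the correction
in the mixed difference.
\<close>

lemma consistency_identity:
  fixes H \<kappa> :: real
  shows "(r1 + g20 + H / 12 * g40 + H\<^sup>2 / 360 * g60) + (r2 + g02 + H / 12 * g04 + H\<^sup>2 / 360 * g06)
      + H / 6 * (1 + \<kappa> * H / 30) * (r3 + g22 + H / 12 * (g42 + g24))
      + (1 - \<kappa> * H / 12 * (1 - \<kappa> * H / 30)) * \<kappa> * g00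
      - ((1 - \<kappa> * H / 12 * (1 - \<kappa> * H / 30)) * (g20 + g02 + \<kappa> * g00)
        + H / 12 * (1 - \<kappa> * H / 30) * ((g40 + g22 + \<kappa> * g20) + (g22 + g04 + \<kappa> * g02))
        + H\<^sup>2 / 360 * ((r4 + (g60 + g42 + \<kappa> * g40)) + (r5 + (g24 + g06 + \<kappa> * g04)))
        + H\<^sup>2 / 90 * (r6 + (g42 + g24 + \<kappa> * g22)))
    = r1 + r2 + H / 6 * (1 + \<kappa> * H / 30) * r3 + \<kappa> * H ^ 3 / 2160 * (g42 + g24)
      - H\<^sup>2 / 360 * (r4 + r5) - H\<^sup>2 / 90 * r6"
  by (simp add: algebra_simps power2_eq_square power3_eq_cube add_divide_distrib diff_divide_distrib)

text \<open>
The remainders \<open>r1\<close>, \<open>r2\<close> are of order \<open>h^6\<close>, \<open>r3\<close> of order \<open>h^4\<close>, and \<open>r4\<close>, \<open>r5\<close>, \<open>r6\<close> of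
order \<open>h^2\<close>; the powers of \<open>h\<close> in front of them make up the difference to \<open>h^6\<close>.
The number \<open>15\<close> makes the factor \<open>1 + K\<^sup>2 h\<^sup>2 / 30\<close> at most \<open>3 / 2\<close>.
\<close>

lemma truncation_error_jet:
  assumes jet: "jet_on 8 a b c d G"
    and boundG: "\<And>r s p. r + s \<le> 8 \<Longrightarrow> p \<in> rect a b c d \<Longrightarrow> \<bar>G r s p\<bar> \<le> M"
    and F: "F = (\<lambda>r s p. G (r + 2) s p + G r (s + 2) p + K\<^sup>2 * G r s p)"
    and boundF: "\<And>r s p. r + s \<le> 6 \<Longrightarrow> p \<in> rect a b c d \<Longrightarrow> \<bar>F r s p\<bar> \<le> M'"
    and h: "h > 0" and Kh: "K\<^sup>2 * h\<^sup>2 \<le> 15"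
    and x: "x \<in> {a..b}" "x - h \<in> {a..b}" "x + h \<in> {a..b}"
    and y: "y \<in> {c..d}" "y - h \<in> {c..d}" "y + h \<in> {c..d}"
  shows "\<bar>second_quotient h (\<lambda>\<xi>. G 0 0 (\<xi>, y)) x + second_quotient h (\<lambda>\<eta>. G 0 0 (x, \<eta>)) y
     + h^2 / 6 * (1 + K^2 * h^2 / 30) * second_quotient h (\<lambda>\<xi>. second_quotient h (\<lambda>\<eta>. G 0 0 (\<xi>, \<eta>)) y) x
     + (1 - K^2 * h^2 / 12 * (1 - K^2 * h^2 / 30)) * K^2 * G 0 0 (x, y)
     - ((1 - K^2 * h^2 / 12 * (1 - K^2 * h^2 / 30)) * F 0 0 (x, y)
       + h^2 / 12 * (1 - K^2 * h^2 / 30) * (F 2 0 (x, y) + F 0 2 (x, y))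
       + h^4 / 360 * (second_quotient h (\<lambda>\<xi>. F 2 0 (\<xi>, y)) x + second_quotient h (\<lambda>\<eta>. F 0 2 (x, \<eta>)) y)
       + h^4 / 90 * second_quotient h (\<lambda>\<xi>. second_quotient h (\<lambda>\<eta>. F 0 0 (\<xi>, \<eta>)) y) x)\<bar>
    \<le> ((4 + K\<^sup>2) * M + M') * h ^ 6"
proof -
  note G = jet boundG h x y
  have "jet_on 6 a b c d F" using helmholtz_jet[of 6 a b c d G F K] jet F by simp
  note F' = this boundF h x y
  define g where "g = (\<lambda>r s. G r s (x, y))"
  have M: "0 \<le> M" using boundG[of 0 0 "(x, y)"] x y by auto
  have M': "0 \<le> M'" using boundF[of 0 0 "(x, y)"] x y by auto
  define r1 where "r1 = second_quotient h (\<lambda>\<xi>. G 0 0 (\<xi>, y)) x - g 2 0 - h\<^sup>2 / 12 * g 4 0 - h ^ 4 / 360 * g 6 0"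
  define r2 where "r2 = second_quotient h (\<lambda>\<eta>. G 0 0 (x, \<eta>)) y - g 0 2 - h\<^sup>2 / 12 * g 0 4 - h ^ 4 / 360 * g 0 6"
  define r3 where "r3 = second_quotient h (\<lambda>\<xi>. second_quotient h (\<lambda>\<eta>. G 0 0 (\<xi>, \<eta>)) y) x - g 2 2 - h\<^sup>2 / 12 * (g 4 2 + g 2 4)"
  define r4 where "r4 = second_quotient h (\<lambda>\<xi>. F 2 0 (\<xi>, y)) x - F 4 0 (x, y)"
  define r5 where "r5 = second_quotient h (\<lambda>\<eta>. F 0 2 (x, \<eta>)) y - F 0 4 (x, y)"
  define r6 where "r6 = second_quotient h (\<lambda>\<xi>. second_quotient h (\<lambda>\<eta>. F 0 0 (\<xi>, \<eta>)) y) x - F 2 2 (x, y)"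
  have r1: "\<bar>r1\<bar> \<le> M * h ^ 6" using jet_second_quotient_x(3)[OF G, of 0 0] by (simp add: r1_def g_def del: add_2_eq_Suc')
  have r2: "\<bar>r2\<bar> \<le> M * h ^ 6" using jet_second_quotient_y(3)[OF G x(1), of 0 0] by (simp add: r2_def g_def del: add_2_eq_Suc')
  have r3: "\<bar>r3\<bar> \<le> 4 * M * h ^ 4" using jet_second_quotient_xy_order4[OF G] by (simp add: r3_def g_def)
  have r4: "\<bar>r4\<bar> \<le> M' * h\<^sup>2" using jet_second_quotient_x(1)[OF F', of 2 0] by (simp add: r4_def)
  have r5: "\<bar>r5\<bar> \<le> M' * h\<^sup>2" using jet_second_quotient_y(1)[OF F' x(1), of 0 2] by (simp add: r5_def)
  have r6: "\<bar>r6\<bar> \<le> 3 * M' * h\<^sup>2" using jet_second_quotient_xy_order2[OF F'] by (simp add: r6_def)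
  have Fg: "F r s (x, y) = g (r + 2) s + g r (s + 2) + K\<^sup>2 * g r s" for r s
    by (simp add: F g_def)
  define \<kappa> where "\<kappa> = K\<^sup>2"
  let ?E = "r1 + r2 + h\<^sup>2 / 6 * (1 + \<kappa> * h\<^sup>2 / 30) * r3 + \<kappa> * h ^ 6 / 2160 * (g 4 2 + g 2 4)
    - h ^ 4 / 360 * (r4 + r5) - h ^ 4 / 90 * r6"
  have id: "second_quotient h (\<lambda>\<xi>. G 0 0 (\<xi>, y)) x + second_quotient h (\<lambda>\<eta>. G 0 0 (x, \<eta>)) y
     + h^2 / 6 * (1 + K^2 * h^2 / 30) * second_quotient h (\<lambda>\<xi>. second_quotient h (\<lambda>\<eta>. G 0 0 (\<xi>, \<eta>)) y) x
     + (1 - K^2 * h^2 / 12 * (1 - K^2 * h^2 / 30)) * K^2 * G 0 0 (x, y)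
     - ((1 - K^2 * h^2 / 12 * (1 - K^2 * h^2 / 30)) * F 0 0 (x, y)
       + h^2 / 12 * (1 - K^2 * h^2 / 30) * (F 2 0 (x, y) + F 0 2 (x, y))
       + h^4 / 360 * (second_quotient h (\<lambda>\<xi>. F 2 0 (\<xi>, y)) x + second_quotient h (\<lambda>\<eta>. F 0 2 (x, \<eta>)) y)
       + h^4 / 90 * second_quotient h (\<lambda>\<xi>. second_quotient h (\<lambda>\<eta>. F 0 0 (\<xi>, \<eta>)) y) x) = ?E"
  proof -
    have s: "second_quotient h (\<lambda>\<xi>. G 0 0 (\<xi>, y)) x = r1 + g 2 0 + h\<^sup>2 / 12 * g 4 0 + h ^ 4 / 360 * g 6 0"
      "second_quotient h (\<lambda>\<eta>. G 0 0 (x, \<eta>)) y = r2 + g 0 2 + h\<^sup>2 / 12 * g 0 4 + h ^ 4 / 360 * g 0 6"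
      "second_quotient h (\<lambda>\<xi>. second_quotient h (\<lambda>\<eta>. G 0 0 (\<xi>, \<eta>)) y) x = r3 + g 2 2 + h\<^sup>2 / 12 * (g 4 2 + g 2 4)"
      "second_quotient h (\<lambda>\<xi>. F 2 0 (\<xi>, y)) x = r4 + (g 6 0 + g 4 2 + \<kappa> * g 4 0)"
      "second_quotient h (\<lambda>\<eta>. F 0 2 (x, \<eta>)) y = r5 + (g 2 4 + g 0 6 + \<kappa> * g 0 4)"
      "second_quotient h (\<lambda>\<xi>. second_quotient h (\<lambda>\<eta>. F 0 0 (\<xi>, \<eta>)) y) x = r6 + (g 4 2 + g 2 4 + \<kappa> * g 2 2)"
      by (simp_all add: r1_def r2_def r3_def r4_def r5_def r6_def Fg \<kappa>_def del: add_2_eq_Suc')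
    have t: "F 0 0 (x, y) = g 2 0 + g 0 2 + \<kappa> * g 0 0" "F 2 0 (x, y) = g 4 0 + g 2 2 + \<kappa> * g 2 0"
      "F 0 2 (x, y) = g 2 2 + g 0 4 + \<kappa> * g 0 2" "G 0 0 (x, y) = g 0 0"
      using Fg[of 0 0] Fg[of 2 0] Fg[of 0 2] by (simp_all add: g_def \<kappa>_def del: add_2_eq_Suc')
    have pow: "h ^ 4 = (h\<^sup>2)\<^sup>2" "h ^ 6 = (h\<^sup>2) ^ 3" by simp_all
    show ?thesis unfolding s t \<kappa>_def[symmetric] pow by (rule consistency_identity)
  qed
  have g: "\<bar>g r s\<bar> \<le> M" if "r + s \<le> 8" for r s
    unfolding g_def by (rule boundG) (use that x y in auto)
  have \<kappa>: "0 \<le> \<kappa>" "\<kappa> * h\<^sup>2 \<le> 15" using Kh by (simp_all add: \<kappa>_def)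
  have e3: "\<bar>h\<^sup>2 / 6 * (1 + \<kappa> * h\<^sup>2 / 30) * r3\<bar> \<le> M * h ^ 6"
  proof -
    have "\<bar>h\<^sup>2 / 6 * (1 + \<kappa> * h\<^sup>2 / 30) * r3\<bar> = h\<^sup>2 / 6 * (1 + \<kappa> * h\<^sup>2 / 30) * \<bar>r3\<bar>"
      using \<kappa> by (simp add: abs_mult)
    also have "\<dots> \<le> h\<^sup>2 / 6 * (3 / 2) * (4 * M * h ^ 4)"
      using \<kappa> M r3 by (intro mult_mono) auto
    also have "\<dots> = M * h ^ 6" by (simp add: eval_nat_numeral)
    finally show ?thesis .
  qed
  have e4: "\<bar>\<kappa> * h ^ 6 / 2160 * (g 4 2 + g 2 4)\<bar> \<le> \<kappa> * M * h ^ 6"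
  proof -
    have "\<bar>\<kappa> * h ^ 6 / 2160 * (g 4 2 + g 2 4)\<bar> = \<kappa> * h ^ 6 / 2160 * \<bar>g 4 2 + g 2 4\<bar>"
      using \<kappa> h by (simp add: abs_mult)
    also have "\<dots> \<le> \<kappa> * h ^ 6 / 2160 * (2160 * M)"
      using \<kappa> h g[of 4 2] g[of 2 4] M by (intro mult_left_mono) auto
    finally show ?thesis by (simp add: mult_ac)
  qed
  have e5: "\<bar>h ^ 4 / 360 * (r4 + r5)\<bar> \<le> M' * h ^ 6 / 180"
  proof -
    have "\<bar>h ^ 4 / 360 * (r4 + r5)\<bar> = h ^ 4 / 360 * \<bar>r4 + r5\<bar>" using h by (simp add: abs_mult)
    also have "\<dots> \<le> h ^ 4 / 360 * (2 * (M' * h\<^sup>2))"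
      using h r4 r5 by (intro mult_left_mono) auto
    finally show ?thesis by (simp add: eval_nat_numeral mult_ac)
  qed
  have e6: "\<bar>h ^ 4 / 90 * r6\<bar> \<le> M' * h ^ 6 / 30"
  proof -
    have "\<bar>h ^ 4 / 90 * r6\<bar> = h ^ 4 / 90 * \<bar>r6\<bar>" using h by (simp add: abs_mult)
    also have "\<dots> \<le> h ^ 4 / 90 * (3 * M' * h\<^sup>2)"
      using h r6 by (intro mult_left_mono) auto
    finally show ?thesis by (simp add: eval_nat_numeral mult_ac)
  qed
  have nn: "0 \<le> M * h ^ 6" "0 \<le> M' * h ^ 6" using M M' h by auto
  have "((4 + K\<^sup>2) * M + M') * h ^ 6 = 4 * (M * h ^ 6) + \<kappa> * M * h ^ 6 + M' * h ^ 6"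
    by (simp add: \<kappa>_def algebra_simps)
  then show ?thesis unfolding id using r1 r2 e3 e4 e5 e6 nn by linarith
qed

lemma \<delta>x2_on_grid:
  "i > 0 \<Longrightarrow> \<delta>x2 h (on_grid a c h w) i j = second_quotient h (\<lambda>\<xi>. w (\<xi>, c + real j * h)) (a + real i * h)"
  by (simp add: \<delta>x2_def on_grid_def grid_pt_def second_quotient_def of_nat_diff algebra_simps)

lemma \<delta>y2_on_grid:
  "j > 0 \<Longrightarrow> \<delta>y2 h (on_grid a c h w) i j = second_quotient h (\<lambda>\<eta>. w (a + real i * h, \<eta>)) (c + real j * h)"
  by (simp add: \<delta>y2_def on_grid_def grid_pt_def second_quotient_def of_nat_diff algebra_simps)

lemma \<delta>x2_\<delta>y2_on_grid:
  assumes "i > 0" "j > 0"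
  shows "\<delta>x2 h (\<delta>y2 h (on_grid a c h w)) i j
    = second_quotient h (\<lambda>\<xi>. second_quotient h (\<lambda>\<eta>. w (\<xi>, \<eta>)) (c + real j * h)) (a + real i * h)"
  unfolding \<delta>x2_def \<delta>y2_on_grid[OF assms(2)] second_quotient_def[of h _ "a + real i * h"]
  using assms(1) by (simp add: of_nat_diff algebra_simps)

lemma second_quotient_cong:
  "\<phi> (x - h) = \<psi> (x - h) \<Longrightarrow> \<phi> x = \<psi> x \<Longrightarrow> \<phi> (x + h) = \<psi> (x + h) \<Longrightarrow> second_quotient h \<phi> x = second_quotient h \<psi> x"
  by (simp add: second_quotient_def)

lemma scheme_lhs_diff:
  "scheme_lhs h K (\<lambda>i j. v i j - w i j) i j = scheme_lhs h K v i j - scheme_lhs h K w i j"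
proof -
  have x: "\<delta>x2 h (\<lambda>i j. v i j - w i j) i j = \<delta>x2 h v i j - \<delta>x2 h w i j" for v w i j
    by (simp add: \<delta>x2_def diff_divide_distrib add_divide_distrib)
  have y: "\<delta>y2 h (\<lambda>i j. v i j - w i j) = (\<lambda>i j. \<delta>y2 h v i j - \<delta>y2 h w i j)" for v w
    by (intro ext) (simp add: \<delta>y2_def diff_divide_distrib add_divide_distrib)
  show ?thesis unfolding scheme_lhs_def y x right_diff_distrib by linarith
qed

text \<open>
The equation is given in the open rectangle only, but the right-hand side of the scheme
differentiates \<open>f\<close> and uses values on the edges. By continuity the equation
holds on the closed rectangle, so there the derivatives of \<open>f\<close> are the members of the family \<open>F\<close>.
\<close>

lemma scheme_consistency:
  assumes ab: "a < b" "c < d"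
    and f: "continuous_on (rect a b c d) f"
    and u: "Ck_on 8 (rect a b c d) u" "dirichlet_solution (rect a b c d) K f \<Phi> u"
  shows "\<exists>C\<ge>0. \<forall>N h i j. a + real N * h = b \<and> c + real N * h = d \<and> h > 0 \<and> K\<^sup>2 * h\<^sup>2 \<le> 15 \<and>
      i \<in> {1..<N} \<and> j \<in> {1..<N} \<longrightarrow>
      \<bar>scheme_lhs h K (on_grid a c h u) i j - scheme_rhs a c (rect a b c d) h K f i j\<bar> \<le> C * h ^ 6"
proof -
  let ?S = "rect a b c d"
  define G where "G = (\<lambda>r s. (dx_on ?S ^^ r) ((dy_on ?S ^^ s) u))"
  have jet: "jet_on 8 a b c d G" unfolding G_def by (rule Ck_on_jet[OF ab u(1)])
  have G00: "G 0 0 = u" by (simp add: G_def)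
  define F where "F = (\<lambda>r s p. G (r + 2) s p + G r (s + 2) p + K\<^sup>2 * G r s p)"
  have jetF: "jet_on 6 a b c d F" using helmholtz_jet[of 6 a b c d G F K] jet F_def by simp
  obtain M where M: "M \<ge> 0" "\<And>r s p. r + s \<le> 8 \<Longrightarrow> p \<in> ?S \<Longrightarrow> \<bar>G r s p\<bar> \<le> M"
    using jet_on_bounded[OF jet] by blast
  obtain M' where M': "M' \<ge> 0" "\<And>r s p. r + s \<le> 6 \<Longrightarrow> p \<in> ?S \<Longrightarrow> \<bar>F r s p\<bar> \<le> M'"
    using jet_on_bounded[OF jetF] by blast
  have f0: "f p = F 0 0 p" if "p \<in> ?S" for p
  proof -
    have cl: "closure (interior ?S) = ?S"
      using ab by (simp add: interior_Times closure_Times)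
    have "F 0 0 q - f q = 0" if "q \<in> interior ?S" for q
      using u(2) that
      by (auto simp: dirichlet_solution_def F_def G_def laplace_on_def simp del: add_2_eq_Suc')
    moreover have "continuous_on (closure (interior ?S)) (\<lambda>q. F 0 0 q - f q)"
      unfolding cl using jetF f by (intro continuous_on_diff) (auto simp: jet_on_def)
    ultimately have "F 0 0 p - f p = 0"
      using continuous_constant_on_closure[of "interior ?S" "\<lambda>q. F 0 0 q - f q" 0 p] that cl by simp
    then show ?thesis by simp
  qed
  have fxx: "(dx_on ?S ^^ 2) f p = F 2 0 p" if "p \<in> ?S" for p
  proof -
    have d: "dx_on ?S (F r 0) q = F (Suc r) 0 q" if "q \<in> ?S" "r < 6" for q r
      using that by (cases q) (auto intro!: dx_on_eqI ab jet_on_dx[OF jetF])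
    have "(dx_on ?S ^^ 2) f p = dx_on ?S (dx_on ?S f) p" by (simp add: numeral_2_eq_2)
    also have "\<dots> = dx_on ?S (F 1 0) p"
    proof (rule dx_on_cong[OF _ that])
      fix q assume q: "q \<in> ?S"
      show "dx_on ?S f q = F 1 0 q" using dx_on_cong[OF f0 q] d[OF q, of 0] by simp
    qed
    finally show ?thesis using d[OF that, of 1] by (simp add: numeral_2_eq_2)
  qed
  have fyy: "(dy_on ?S ^^ 2) f p = F 0 2 p" if "p \<in> ?S" for p
  proof -
    have d: "dy_on ?S (F 0 s) q = F 0 (Suc s) q" if "q \<in> ?S" "s < 6" for q s
      using that by (cases q) (auto intro!: dy_on_eqI ab jet_on_dy[OF jetF])
    have "(dy_on ?S ^^ 2) f p = dy_on ?S (dy_on ?S f) p" by (simp add: numeral_2_eq_2)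
    also have "\<dots> = dy_on ?S (F 0 1) p"
    proof (rule dy_on_cong[OF _ that])
      fix q assume q: "q \<in> ?S"
      show "dy_on ?S f q = F 0 1 q" using dy_on_cong[OF f0 q] d[OF q, of 0] by simp
    qed
    finally show ?thesis using d[OF that, of 1] by (simp add: numeral_2_eq_2)
  qed
  have "\<bar>scheme_lhs h K (on_grid a c h u) i j - scheme_rhs a c ?S h K f i j\<bar>
      \<le> ((4 + K\<^sup>2) * M + M') * h ^ 6"
    if N: "a + real N * h = b" "c + real N * h = d" and h: "h > 0" and Kh: "K\<^sup>2 * h\<^sup>2 \<le> 15"
      and ij: "i \<in> {1..<N}" "j \<in> {1..<N}" for N h i j
  proof -
    define x y where "x = a + real i * h" and "y = c + real j * h"
    have pos: "i > 0" "j > 0" using ij by auto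
    have bd: "0 \<le> real k * h \<and> real k * h - h \<ge> 0 \<and> real k * h + h \<le> real N * h"
      if "k \<in> {1..<N}" for k
    proof -
      have "1 \<le> real k" "real k + 1 \<le> real N" using that by auto
      then have "1 * h \<le> real k * h" "(real k + 1) * h \<le> real N * h"
        using h by (auto intro!: mult_right_mono simp del: mult_le_cancel_right)
      then show ?thesis using h by (simp add: algebra_simps)
    qed
    have x: "x \<in> {a..b}" "x - h \<in> {a..b}" "x + h \<in> {a..b}"
      using bd[OF ij(1)] h N unfolding x_def by auto
    have y: "y \<in> {c..d}" "y - h \<in> {c..d}" "y + h \<in> {c..d}"
      using bd[OF ij(2)] h N unfolding y_def by auto
    have lhs: "scheme_lhs h K (on_grid a c h u) i j
      = second_quotient h (\<lambda>\<xi>. G 0 0 (\<xi>, y)) x + second_quotient h (\<lambda>\<eta>. G 0 0 (x, \<eta>)) y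
     + h^2 / 6 * (1 + K^2 * h^2 / 30) * second_quotient h (\<lambda>\<xi>. second_quotient h (\<lambda>\<eta>. G 0 0 (\<xi>, \<eta>)) y) x
     + (1 - K^2 * h^2 / 12 * (1 - K^2 * h^2 / 30)) * K^2 * G 0 0 (x, y)"
      unfolding scheme_lhs_def \<delta>x2_on_grid[OF pos(1)] \<delta>y2_on_grid[OF pos(2)]
        \<delta>x2_\<delta>y2_on_grid[OF pos] G00 x_def y_def
      by (simp add: on_grid_def grid_pt_def)
    have s: "second_quotient h (\<lambda>\<xi>. (dx_on ?S ^^ 2) f (\<xi>, y)) x = second_quotient h (\<lambda>\<xi>. F 2 0 (\<xi>, y)) x"
      "second_quotient h (\<lambda>\<eta>. (dy_on ?S ^^ 2) f (x, \<eta>)) y = second_quotient h (\<lambda>\<eta>. F 0 2 (x, \<eta>)) y"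
      by (rule second_quotient_cong; rule fxx fyy; use x y in simp)+
    have sy: "second_quotient h (\<lambda>\<eta>. f (\<xi>, \<eta>)) y = second_quotient h (\<lambda>\<eta>. F 0 0 (\<xi>, \<eta>)) y" if "\<xi> \<in> {a..b}" for \<xi>
      by (rule second_quotient_cong; rule f0; use y that in simp)
    have sxy: "second_quotient h (\<lambda>\<xi>. second_quotient h (\<lambda>\<eta>. f (\<xi>, \<eta>)) y) x = second_quotient h (\<lambda>\<xi>. second_quotient h (\<lambda>\<eta>. F 0 0 (\<xi>, \<eta>)) y) x"
      by (rule second_quotient_cong; rule sy; fact x)
    have xy: "(x, y) \<in> ?S" using x y by simp
    have rhs: "scheme_rhs a c ?S h K f i j
      = (1 - K^2 * h^2 / 12 * (1 - K^2 * h^2 / 30)) * F 0 0 (x, y)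
       + h^2 / 12 * (1 - K^2 * h^2 / 30) * (F 2 0 (x, y) + F 0 2 (x, y))
       + h^4 / 360 * (second_quotient h (\<lambda>\<xi>. F 2 0 (\<xi>, y)) x + second_quotient h (\<lambda>\<eta>. F 0 2 (x, \<eta>)) y)
       + h^4 / 90 * second_quotient h (\<lambda>\<xi>. second_quotient h (\<lambda>\<eta>. F 0 0 (\<xi>, \<eta>)) y) x"
      unfolding scheme_rhs_def \<delta>x2_on_grid[OF pos(1)] \<delta>y2_on_grid[OF pos(2)]
        \<delta>x2_\<delta>y2_on_grid[OF pos] x_def[symmetric] y_def[symmetric] s sxy
      unfolding laplace_on_def on_grid_def grid_pt_def x_def[symmetric] y_def[symmetric]
        fxx[OF xy] fyy[OF xy] f0[OF xy] ..
    show ?thesis unfolding lhs rhs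
      by (rule truncation_error_jet[OF jet M(2) F_def M'(2) h Kh x y])
  qed
  then show ?thesis
    using M(1) M'(1) by (intro exI[of _ "(4 + K\<^sup>2) * M + M'"]) auto
qed

section \<open>The discrete sine transform\<close>

text \<open>
The Dirichlet kernel: multiplying by \<open>2 sin (x / 2)\<close> makes the sum telescope.
\<close>

lemma sum_cos_multiples:
  fixes x :: real
  assumes "sin (real N * x) = 0" "sin (x / 2) \<noteq> 0"
  shows "2 * (\<Sum>i<N. cos (real i * x)) = 1 - cos (real N * x)"
proof -
  have "2 * sin (x / 2) * (\<Sum>i<n. cos (real i * x)) = sin (real n * x - x / 2) + sin (x / 2)" for n
  proof (induction n)
    case (Suc n)
    have "2 * sin (x / 2) * cos (real n * x) = sin (real n * x + x / 2) - sin (real n * x - x / 2)"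
      by (simp add: sin_add sin_diff)
    moreover have *: "real (Suc n) * x - x / 2 = real n * x + x / 2" by (simp add: field_simps)
    ultimately show ?case using Suc unfolding * by (simp add: distrib_left)
  qed simp
  then have "2 * sin (x / 2) * (\<Sum>i<N. cos (real i * x)) = sin (x / 2) * (1 - cos (real N * x))"
    using assms(1) by (simp add: sin_diff algebra_simps)
  then have "sin (x / 2) * (2 * (\<Sum>i<N. cos (real i * x))) = sin (x / 2) * (1 - cos (real N * x))"
    by (simp only: mult.assoc mult.left_commute[of 2])
  with assms(2) show ?thesis using mult_cancel_left by blast
qed

definition sine_mode :: "nat \<Rightarrow> nat \<Rightarrow> nat \<Rightarrow> real" where
  "sine_mode N m i = sin (pi * real m * real i / real N)"

lemma sine_mode_commute: "sine_mode N m i = sine_mode N i m"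
  by (simp add: sine_mode_def mult_ac)

lemma sine_mode_boundary [simp]: "sine_mode N m 0 = 0" "N > 0 \<Longrightarrow> sine_mode N m N = 0"
  by (simp_all add: sine_mode_def)

text \<open>
The product of two modes is half the difference of cosines with frequencies \<open>m - n\<close> and \<open>m + n\<close>.
These have equal parity, so for \<open>m \<noteq> n\<close> the two cosine sums agree and cancel; for \<open>m = n\<close> the
first is \<open>N\<close> and the second vanishes.
\<close>

lemma sine_mode_orthogonal:
  assumes "m \<in> {1..<N}" "n \<in> {1..<N}"
  shows "(\<Sum>i\<in>{1..<N}. sine_mode N m i * sine_mode N n i) = (if m = n then real N / 2 else 0)"
proof -
  have N: "N > 0" using assms by auto
  define x y where "x = pi * (real m - real n) / real N" and "y = pi * (real m + real n) / real N"
  have "(\<Sum>i\<in>{1..<N}. sine_mode N m i * sine_mode N n i) = (\<Sum>i<N. sine_mode N m i * sine_mode N n i)"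
    by (rule sum.mono_neutral_left) (auto simp: not_less_eq_eq)
  also have "\<dots> = (\<Sum>i<N. (cos (real i * x) - cos (real i * y)) / 2)"
  proof (rule sum.cong)
    fix i
    have *: "real i * x = pi * real m * real i / real N - pi * real n * real i / real N"
      "real i * y = pi * real m * real i / real N + pi * real n * real i / real N"
      using N by (simp_all add: x_def y_def field_simps)
    show "sine_mode N m i * sine_mode N n i = (cos (real i * x) - cos (real i * y)) / 2"
      unfolding sine_mode_def sin_times_sin * by simp
  qed simp
  also have "\<dots> = (2 * (\<Sum>i<N. cos (real i * x)) - 2 * (\<Sum>i<N. cos (real i * y))) / 4"
    by (simp add: sum_subtractf flip: sum_divide_distrib)
  finally have *: "(\<Sum>i\<in>{1..<N}. sine_mode N m i * sine_mode N n i) = \<dots>" .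
  have Nx: "real N * x = real m * pi - real n * pi" and Ny: "real N * y = real m * pi + real n * pi"
    using N by (simp_all add: x_def y_def field_simps)
  have s: "sin (real N * x) = 0" "sin (real N * y) = 0" and c: "cos (real N * x) = cos (real N * y)"
    unfolding Nx Ny by (simp_all add: sin_add sin_diff cos_add cos_diff)
  have sy: "sin (y / 2) \<noteq> 0"
  proof -
    have "0 < y / 2" "y / 2 < pi"
      using assms N by (auto simp: y_def field_simps simp flip: of_nat_add)
    then show ?thesis using sin_gt_zero by fastforce
  qed
  show ?thesis
  proof (cases "m = n")
    case True
    then have "x = 0" by (simp add: x_def)
    with c have "cos (real N * y) = 1" by simp
    with sum_cos_multiples[OF s(2) sy] \<open>x = 0\<close> True show ?thesis unfolding * by simp
  next
    case False
    have "sin (x / 2) \<noteq> 0"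
    proof -
      have "x \<noteq> 0" using False N by (simp add: x_def)
      moreover have "\<bar>x / 2\<bar> < pi"
      proof -
        have "\<bar>real m - real n\<bar> < real N" using assms by auto
        then have "pi * (\<bar>real m - real n\<bar> / (2 * real N)) < pi * 1"
          using N by (intro mult_strict_left_mono) auto
        then show ?thesis using N by (simp add: x_def abs_mult)
      qed
      ultimately show ?thesis using sin_gt_zero[of "x/2"] sin_gt_zero[of "-x/2"]
        by (cases "x > 0") (auto simp: abs_if split: if_splits)
    qed
    from sum_cos_multiples[OF s(1) this] sum_cos_multiples[OF s(2) sy] c False
    show ?thesis unfolding * by simp
  qed
qed

definition dst1 :: "nat \<Rightarrow> (nat \<Rightarrow> real) \<Rightarrow> nat \<Rightarrow> real" where
  "dst1 N g m = (\<Sum>i\<in>{1..<N}. sine_mode N m i * g i)"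

text \<open>
The mode is symmetric in its two arguments, so orthogonality also says that the square of the transform is
\<open>N / 2\<close> times the identity.
\<close>

lemma dst1_inversion:
  assumes "i \<in> {1..<N}"
  shows "dst1 N (dst1 N g) i = real N / 2 * g i"
proof -
  have "dst1 N (dst1 N g) i = (\<Sum>m\<in>{1..<N}. \<Sum>j\<in>{1..<N}. sine_mode N i m * sine_mode N j m * g j)"
    unfolding dst1_def sum_distrib_left mult.assoc
    by (intro sum.cong refl) (metis sine_mode_commute)
  also have "\<dots> = (\<Sum>j\<in>{1..<N}. (\<Sum>m\<in>{1..<N}. sine_mode N i m * sine_mode N j m) * g j)"
    by (subst sum.swap) (simp add: sum_distrib_right)
  also have "\<dots> = (\<Sum>j\<in>{1..<N}. if i = j then real N / 2 * g j else 0)"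
    by (rule sum.cong) (use assms sine_mode_orthogonal[of i N] in auto)
  also have "\<dots> = real N / 2 * g i"
    using assms by simp
  finally show ?thesis .
qed

lemma dst1_parseval: "(\<Sum>m\<in>{1..<N}. (dst1 N g m)\<^sup>2) = real N / 2 * (\<Sum>i\<in>{1..<N}. (g i)\<^sup>2)"
proof -
  have "(\<Sum>m\<in>{1..<N}. (dst1 N g m)\<^sup>2)
      = (\<Sum>m\<in>{1..<N}. \<Sum>i\<in>{1..<N}. g i * (sine_mode N i m * dst1 N g m))"
  proof (intro sum.cong refl)
    fix m
    have "(dst1 N g m)\<^sup>2 = (\<Sum>i\<in>{1..<N}. sine_mode N m i * g i) * dst1 N g m"
      by (simp add: power2_eq_square dst1_def)
    also have "\<dots> = (\<Sum>i\<in>{1..<N}. sine_mode N m i * g i * dst1 N g m)"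
      by (rule sum_distrib_right)
    finally show "(dst1 N g m)\<^sup>2 = (\<Sum>i\<in>{1..<N}. g i * (sine_mode N i m * dst1 N g m))"
      by (simp add: sine_mode_commute[of N m] mult_ac)
  qed
  also have "\<dots> = (\<Sum>i\<in>{1..<N}. g i * dst1 N (dst1 N g) i)"
    by (subst sum.swap) (simp add: sum_distrib_left dst1_def[of N "dst1 N g"])
  also have "\<dots> = (\<Sum>i\<in>{1..<N}. real N / 2 * (g i)\<^sup>2)"
    by (rule sum.cong) (use dst1_inversion in \<open>auto simp: power2_eq_square\<close>)
  finally show ?thesis by (simp add: sum_distrib_left)
qed

text \<open>
Summation by parts moves the second difference from \<open>e\<close> to the sine mode, which is an eigenvector.
The boundary terms disappear because \<open>e\<close> and the mode both vanish at \<open>0\<close> and \<open>N\<close>.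
\<close>

lemma dst1_second_difference:
  assumes "e 0 = 0" "e N = 0"
  shows "dst1 N (\<lambda>i. e (i - 1) - 2 * e i + e (i + 1)) m
    = - (4 * (sin (pi * real m / (2 * real N)))\<^sup>2) * dst1 N e m"
proof (cases N)
  case 0
  then show ?thesis by (simp add: dst1_def)
next
  case (Suc M)
  let ?s = "sine_mode N m"
  have N: "N > 0" using Suc by simp
  have set: "{1..<N} = {1..M}" "{1..<N} = {Suc 0..<Suc M}" using Suc by auto
  have left: "(\<Sum>i\<in>{1..<N}. ?s i * e (i - 1)) = (\<Sum>i\<in>{1..<N}. ?s (i + 1) * e i)"
  proof -
    have "(\<Sum>i\<in>{1..<N}. ?s i * e (i - 1)) = (\<Sum>i\<in>{0..<M}. ?s (i + 1) * e i)"
      unfolding set(2) by (subst sum.shift_bounds_Suc_ivl) simp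
    also have "\<dots> = (\<Sum>i\<in>{0..<N}. ?s (i + 1) * e i)"
      using N unfolding Suc by simp
    also have "\<dots> = (\<Sum>i\<in>{1..<N}. ?s (i + 1) * e i)"
      using N assms(1) by (subst sum.atLeast_Suc_lessThan) auto
    finally show ?thesis .
  qed
  have right: "(\<Sum>i\<in>{1..<N}. ?s i * e (i + 1)) = (\<Sum>i\<in>{1..<N}. ?s (i - 1) * e i)"
  proof -
    have "(\<Sum>i\<in>{1..<N}. ?s (i - 1) * e i) = (\<Sum>i\<in>{0..<M}. ?s i * e (i + 1))"
      unfolding set(2) by (subst sum.shift_bounds_Suc_ivl) simp
    also have "\<dots> = (\<Sum>i\<in>{0..<N}. ?s i * e (i + 1))"
      using N assms(2) unfolding Suc by simp
    also have "\<dots> = (\<Sum>i\<in>{1..<N}. ?s i * e (i + 1))"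
      using N by (subst sum.atLeast_Suc_lessThan) auto
    finally show ?thesis by simp
  qed
  have trig: "?s (i + 1) - 2 * ?s i + ?s (i - 1) = - (4 * (sin (pi * real m / (2 * real N)))\<^sup>2) * ?s i"
    if "i \<in> {1..<N}" for i
  proof -
    define t where "t = pi * real m / (2 * real N)"
    define z where "z = pi * real m * real i / real N"
    have "pi * real m * real (i + 1) / real N = z + 2 * t"
      "pi * real m * real (i - 1) / real N = z - 2 * t"
      using that N by (auto simp: z_def t_def field_simps of_nat_diff)
    then have "?s (i + 1) - 2 * ?s i + ?s (i - 1) = sin (z + 2 * t) - 2 * sin z + sin (z - 2 * t)"
      by (simp add: sine_mode_def z_def)
    also have "\<dots> = - (4 * (sin t)\<^sup>2) * sin z"
      unfolding sin_add sin_diff cos_double_sin by (simp add: algebra_simps)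
    finally show ?thesis by (simp add: sine_mode_def z_def t_def)
  qed
  have "dst1 N (\<lambda>i. e (i - 1) - 2 * e i + e (i + 1)) m
      = (\<Sum>i\<in>{1..<N}. ?s i * e (i - 1)) - 2 * (\<Sum>i\<in>{1..<N}. ?s i * e i) + (\<Sum>i\<in>{1..<N}. ?s i * e (i + 1))"
    by (simp add: dst1_def algebra_simps sum.distrib sum_subtractf sum_distrib_left)
  also have "\<dots> = (\<Sum>i\<in>{1..<N}. (?s (i + 1) - 2 * ?s i + ?s (i - 1)) * e i)"
    unfolding left right by (simp add: algebra_simps sum.distrib sum_subtractf sum_distrib_left)
  also have "\<dots> = (\<Sum>i\<in>{1..<N}. - (4 * (sin (pi * real m / (2 * real N)))\<^sup>2) * ?s i * e i)"
    by (rule sum.cong) (use trig in auto)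
  finally show ?thesis by (simp add: dst1_def sum_distrib_left mult.assoc sum_negf)
qed

definition dst2 :: "nat \<Rightarrow> (nat \<Rightarrow> nat \<Rightarrow> real) \<Rightarrow> nat \<Rightarrow> nat \<Rightarrow> real" where
  "dst2 N g m n = dst1 N (\<lambda>i. dst1 N (g i) n) m"

lemma dst1_cong: "(\<And>i. i \<in> {1..<N} \<Longrightarrow> g i = g' i) \<Longrightarrow> dst1 N g m = dst1 N g' m"
  by (simp add: dst1_def)

lemma dst1_add: "dst1 N (\<lambda>i. g i + g' i) m = dst1 N g m + dst1 N g' m"
  by (simp add: dst1_def algebra_simps sum.distrib)

lemma dst1_scale: "dst1 N (\<lambda>i. r * g i) m = r * dst1 N g m"
  by (simp add: dst1_def sum_distrib_left mult_ac)

lemma dst2_swap: "dst2 N g m n = dst1 N (\<lambda>j. dst1 N (\<lambda>i. g i j) m) n"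
  unfolding dst2_def dst1_def sum_distrib_left
  by (subst sum.swap) (simp add: mult_ac)

lemma dst2_cong:
  "(\<And>i j. i \<in> {1..<N} \<Longrightarrow> j \<in> {1..<N} \<Longrightarrow> g i j = g' i j) \<Longrightarrow> dst2 N g m n = dst2 N g' m n"
  by (simp add: dst2_def dst1_def)

lemma dst2_add: "dst2 N (\<lambda>i j. g i j + g' i j) m n = dst2 N g m n + dst2 N g' m n"
  by (simp add: dst2_def dst1_add)

lemma dst2_scale: "dst2 N (\<lambda>i j. r * g i j) m n = r * dst2 N g m n"
  by (simp add: dst2_def dst1_scale)

lemma dst2_inversion:
  assumes "i \<in> {1..<N}" "j \<in> {1..<N}"
  shows "dst2 N (dst2 N g) i j = (real N / 2)\<^sup>2 * g i j"
proof -
  have "dst2 N (dst2 N g) i j = dst1 N (\<lambda>m. dst1 N (\<lambda>n. dst1 N (\<lambda>j. dst1 N (\<lambda>i. g i j) m) n) j) i"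
    unfolding dst2_def[of N "dst2 N g"] dst2_swap[of N g] ..
  also have "\<dots> = dst1 N (\<lambda>m. real N / 2 * dst1 N (\<lambda>i. g i j) m) i"
    by (simp only: dst1_inversion[OF assms(2)])
  also have "\<dots> = (real N / 2)\<^sup>2 * g i j"
    unfolding dst1_scale dst1_inversion[OF assms(1)] by (simp add: power2_eq_square)
  finally show ?thesis .
qed

lemma dst2_parseval:
  "(\<Sum>m\<in>{1..<N}. \<Sum>n\<in>{1..<N}. (dst2 N g m n)\<^sup>2)
    = (real N / 2)\<^sup>2 * (\<Sum>i\<in>{1..<N}. \<Sum>j\<in>{1..<N}. (g i j)\<^sup>2)"
proof -
  have "(\<Sum>m\<in>{1..<N}. \<Sum>n\<in>{1..<N}. (dst2 N g m n)\<^sup>2)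
      = (\<Sum>n\<in>{1..<N}. \<Sum>m\<in>{1..<N}. (dst1 N (\<lambda>i. dst1 N (g i) n) m)\<^sup>2)"
    by (subst sum.swap) (simp add: dst2_def)
  also have "\<dots> = real N / 2 * (\<Sum>n\<in>{1..<N}. \<Sum>i\<in>{1..<N}. (dst1 N (g i) n)\<^sup>2)"
    by (simp only: dst1_parseval sum_distrib_left)
  also have "\<dots> = real N / 2 * (\<Sum>i\<in>{1..<N}. \<Sum>n\<in>{1..<N}. (dst1 N (g i) n)\<^sup>2)"
    by (subst sum.swap) (rule refl)
  also have "\<dots> = real N / 2 * (\<Sum>i\<in>{1..<N}. real N / 2 * (\<Sum>j\<in>{1..<N}. (g i j)\<^sup>2))"
    by (simp only: dst1_parseval)
  also have "\<dots> = (real N / 2)\<^sup>2 * (\<Sum>i\<in>{1..<N}. \<Sum>j\<in>{1..<N}. (g i j)\<^sup>2)"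
    by (simp only: sum_distrib_left[symmetric] power2_eq_square mult.assoc)
  finally show ?thesis .
qed

text \<open>
The eigenvalue of the negative second difference quotient on the mode \<open>m\<close>; it approximates
\<open>(\<pi> m / L)\<^sup>2\<close> when \<open>N h = L\<close> and \<open>m\<close> is small against \<open>N\<close>.
\<close>

definition diff_eigenvalue :: "real \<Rightarrow> nat \<Rightarrow> nat \<Rightarrow> real" where
  "diff_eigenvalue h N m = 4 * (sin (pi * real m / (2 * real N)))\<^sup>2 / h\<^sup>2"

text \<open>
The negative of the eigenvalue of \<open>scheme_lhs\<close> on the product of the modes \<open>m\<close> and \<open>n\<close>. With this
sign it is positive for high frequencies.
\<close>

definition scheme_symbol :: "real \<Rightarrow> real \<Rightarrow> nat \<Rightarrow> nat \<Rightarrow> nat \<Rightarrow> real" where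
  "scheme_symbol h K N m n = diff_eigenvalue h N m + diff_eigenvalue h N n
     - h^2 / 6 * (1 + K^2 * h^2 / 30) * (diff_eigenvalue h N m * diff_eigenvalue h N n)
     - (1 - K^2 * h^2 / 12 * (1 - K^2 * h^2 / 30)) * K^2"

lemma dst2_dx2:
  assumes "\<And>j. j \<in> {1..<N} \<Longrightarrow> e 0 j = 0" "\<And>j. j \<in> {1..<N} \<Longrightarrow> e N j = 0"
  shows "dst2 N (\<delta>x2 h e) m n = - diff_eigenvalue h N m * dst2 N e m n"
proof -
  have "dst2 N (\<delta>x2 h e) m n
      = dst1 N (\<lambda>j. dst1 N (\<lambda>i. 1 / h\<^sup>2 * (e (i - 1) j - 2 * e i j + e (i + 1) j)) m) n"
    unfolding dst2_swap \<delta>x2_def by simp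
  also have "\<dots> = dst1 N (\<lambda>j. - diff_eigenvalue h N m * dst1 N (\<lambda>i. e i j) m) n"
  proof (rule dst1_cong)
    fix j assume "j \<in> {1..<N}"
    with assms have "e 0 j = 0" "e N j = 0" by blast+
    then show "dst1 N (\<lambda>i. 1 / h\<^sup>2 * (e (i - 1) j - 2 * e i j + e (i + 1) j)) m
        = - diff_eigenvalue h N m * dst1 N (\<lambda>i. e i j) m"
      unfolding dst1_scale
      by (subst dst1_second_difference[where e = "\<lambda>i. e i j"]) (simp_all add: diff_eigenvalue_def)
  qed
  finally show ?thesis unfolding dst1_scale dst2_swap .
qed

lemma dst2_dy2:
  assumes "\<And>i. i \<in> {1..<N} \<Longrightarrow> e i 0 = 0" "\<And>i. i \<in> {1..<N} \<Longrightarrow> e i N = 0"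
  shows "dst2 N (\<delta>y2 h e) m n = - diff_eigenvalue h N n * dst2 N e m n"
proof -
  have "dst2 N (\<delta>y2 h e) m n
      = dst1 N (\<lambda>i. dst1 N (\<lambda>j. 1 / h\<^sup>2 * (e i (j - 1) - 2 * e i j + e i (j + 1))) n) m"
    unfolding dst2_def \<delta>y2_def by simp
  also have "\<dots> = dst1 N (\<lambda>i. - diff_eigenvalue h N n * dst1 N (\<lambda>j. e i j) n) m"
  proof (rule dst1_cong)
    fix i assume "i \<in> {1..<N}"
    with assms have "e i 0 = 0" "e i N = 0" by blast+
    then show "dst1 N (\<lambda>j. 1 / h\<^sup>2 * (e i (j - 1) - 2 * e i j + e i (j + 1))) n
        = - diff_eigenvalue h N n * dst1 N (\<lambda>j. e i j) n"
      unfolding dst1_scale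
      by (subst dst1_second_difference[where e = "\<lambda>j. e i j"]) (simp_all add: diff_eigenvalue_def)
  qed
  finally show ?thesis unfolding dst1_scale dst2_def .
qed

lemma dst2_scheme_lhs:
  assumes "\<And>i j. i \<le> N \<Longrightarrow> j \<le> N \<Longrightarrow> i \<in> {0, N} \<or> j \<in> {0, N} \<Longrightarrow> e i j = 0"
  shows "dst2 N (scheme_lhs h K e) m n = - scheme_symbol h K N m n * dst2 N e m n"
proof -
  have x: "dst2 N (\<delta>x2 h e) m n = - diff_eigenvalue h N m * dst2 N e m n"
    and y: "dst2 N (\<delta>y2 h e) m n = - diff_eigenvalue h N n * dst2 N e m n"
    by (rule dst2_dx2; use assms in auto; fail) (rule dst2_dy2; use assms in auto; fail)
  have "dst2 N (\<delta>x2 h (\<delta>y2 h e)) m n = - diff_eigenvalue h N m * dst2 N (\<delta>y2 h e) m n"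
    using assms by (intro dst2_dx2) (auto simp: \<delta>y2_def)
  with y have xy: "dst2 N (\<delta>x2 h (\<delta>y2 h e)) m n = diff_eigenvalue h N m * diff_eigenvalue h N n * dst2 N e m n"
    by simp
  have "dst2 N (scheme_lhs h K e) m n
    = dst2 N (\<lambda>i j. \<delta>x2 h e i j + \<delta>y2 h e i j
     + h^2 / 6 * (1 + K^2 * h^2 / 30) * \<delta>x2 h (\<delta>y2 h e) i j
     + (1 - K^2 * h^2 / 12 * (1 - K^2 * h^2 / 30)) * K^2 * e i j) m n"
    by (rule dst2_cong) (simp add: scheme_lhs_def)
  also have "\<dots> = - scheme_symbol h K N m n * dst2 N e m n"
    unfolding dst2_add dst2_scale x y xy scheme_symbol_def by (simp add: algebra_simps)
  finally show ?thesis .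
qed

section \<open>Stability in the maximum norm\<close>

lemma sum_inverse_squares_le: "(\<Sum>m\<in>{1..<N}. 1 / (real m)\<^sup>2) \<le> 2"
proof -
  have "(\<Sum>m\<in>{1..<Suc M}. 1 / (real m)\<^sup>2) \<le> 2 - 1 / real M" if "M \<ge> 1" for M
    using that
  proof (induction M rule: dec_induct)
    case (step n)
    have "1 / (real (Suc n))\<^sup>2 \<le> 1 / (real n * real (Suc n))"
      using step by (intro divide_left_mono) (auto simp: power2_eq_square)
    also have "\<dots> = 1 / real n - 1 / real (Suc n)"
      using step by (simp add: field_simps)
    finally show ?case using step.IH by simp
  qed simp
  note bound = this
  show ?thesis
  proof (cases "N \<ge> 2")
    case True
    then have "Suc (N - 1) = N" "1 \<le> N - 1" by auto
    with bound[of "N - 1"] have "(\<Sum>m\<in>{1..<N}. 1 / (real m)\<^sup>2) \<le> 2 - 1 / real (N - 1)" by metis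
    also have "\<dots> \<le> 2" by simp
    finally show ?thesis .
  qed simp
qed

text \<open>
The transform of \<open>e\<close> is that of the residual divided by the symbol. By the Cauchy-Schwarz inequality
the inversion formula at a single grid point is bounded by the \<open>l\<^sup>2\<close> norm of the transformed residual,
which Parseval's identity reduces to \<open>\<tau>\<close>, times the \<open>l\<^sup>2\<close> norm of the inverse symbol. The
latter is finite uniformly in \<open>N\<close>, because \<open>2 m n \<le> m\<^sup>2 + n\<^sup>2\<close> reduces its square to a
product of two sums of inverse squares.
\<close>

lemma discrete_stability:
  assumes c: "c > 0"
    and scheme_symbol: "\<And>m n. m \<in> {1..<N} \<Longrightarrow> n \<in> {1..<N} \<Longrightarrow> c * ((real m)\<^sup>2 + (real n)\<^sup>2) \<le> \<bar>scheme_symbol h K N m n\<bar>"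
    and bdry: "\<And>i j. i \<le> N \<Longrightarrow> j \<le> N \<Longrightarrow> i \<in> {0, N} \<or> j \<in> {0, N} \<Longrightarrow> e i j = 0"
    and res: "\<And>i j. i \<in> {1..<N} \<Longrightarrow> j \<in> {1..<N} \<Longrightarrow> \<bar>scheme_lhs h K e i j\<bar> \<le> \<tau>"
    and ij: "i \<in> {1..<N}" "j \<in> {1..<N}"
  shows "\<bar>e i j\<bar> \<le> 2 * \<tau> / c"
proof -
  let ?I = "{1..<N}" and ?R = "scheme_lhs h K e"
  have \<tau>: "\<tau> \<ge> 0" using res[OF ij] by linarith
  have N: "real N > 0" using ij by auto
  define P where "P = (\<lambda>(m, n). dst2 N ?R m n)"
  define Q where "Q = (\<lambda>(m, n). - (sine_mode N i m * sine_mode N j n) / scheme_symbol h K N m n)"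
  have nz: "scheme_symbol h K N m n \<noteq> 0" if "m \<in> ?I" "n \<in> ?I" for m n
  proof -
    have "0 < c * ((real m)\<^sup>2 + (real n)\<^sup>2)" using c that by (auto intro!: mult_pos_pos add_pos_pos)
    with scheme_symbol[OF that] show ?thesis by auto
  qed
  have "(real N / 2)\<^sup>2 * e i j = (\<Sum>m\<in>?I. \<Sum>n\<in>?I. sine_mode N i m * sine_mode N j n * dst2 N e m n)"
    unfolding dst2_inversion[OF ij, symmetric] dst2_def[of N "dst2 N e"]
    by (simp add: dst1_def[of N _ j] dst1_def[of N _ i] sum_distrib_left mult.assoc)
  also have "\<dots> = (\<Sum>m\<in>?I. \<Sum>n\<in>?I. P (m, n) * Q (m, n))"
  proof (intro sum.cong refl)
    fix m n assume "m \<in> ?I" "n \<in> ?I"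
    then have "scheme_symbol h K N m n \<noteq> 0" by (rule nz)
    then show "sine_mode N i m * sine_mode N j n * dst2 N e m n = P (m, n) * Q (m, n)"
      unfolding P_def Q_def prod.case using dst2_scheme_lhs[of N e h K m n, OF bdry] by simp
  qed
  also have "\<dots> = (\<Sum>p\<in>?I \<times> ?I. P p * Q p)"
    by (simp add: sum.cartesian_product)
  finally have rep: "(real N / 2)\<^sup>2 * e i j = (\<Sum>p\<in>?I \<times> ?I. P p * Q p)" .
  have P: "(\<Sum>p\<in>?I \<times> ?I. (P p)\<^sup>2) \<le> (real N / 2)\<^sup>2 * (real N * \<tau>)\<^sup>2"
  proof -
    have "(\<Sum>p\<in>?I \<times> ?I. (P p)\<^sup>2) = (\<Sum>m\<in>?I. \<Sum>n\<in>?I. (dst2 N ?R m n)\<^sup>2)"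
      by (simp add: P_def sum.cartesian_product case_prod_beta)
    also have "\<dots> = (real N / 2)\<^sup>2 * (\<Sum>i\<in>?I. \<Sum>j\<in>?I. (?R i j)\<^sup>2)"
      by (rule dst2_parseval)
    also have "\<dots> \<le> (real N / 2)\<^sup>2 * (\<Sum>i\<in>?I. \<Sum>j\<in>?I. \<tau>\<^sup>2)"
      using res \<tau> by (intro mult_left_mono sum_mono) (auto simp: abs_le_square_iff[symmetric])
    finally have bound: "(\<Sum>p\<in>?I \<times> ?I. (P p)\<^sup>2) \<le> (real N / 2)\<^sup>2 * (\<Sum>i\<in>?I. \<Sum>j\<in>?I. \<tau>\<^sup>2)" .
    have "(\<Sum>i\<in>?I. \<Sum>j\<in>?I. \<tau>\<^sup>2) = real (N - 1) * (real (N - 1) * \<tau>\<^sup>2)"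
      by (simp only: sum_constant card_atLeastLessThan)
    also have "\<dots> \<le> real N * (real N * \<tau>\<^sup>2)" by (intro mult_mono) auto
    finally have "(real N / 2)\<^sup>2 * (\<Sum>i\<in>?I. \<Sum>j\<in>?I. \<tau>\<^sup>2) \<le> (real N / 2)\<^sup>2 * (real N * \<tau>)\<^sup>2"
      by (intro mult_left_mono) (simp_all add: power2_eq_square mult_ac)
    with bound show ?thesis by (rule order_trans)
  qed
  have Q: "(\<Sum>p\<in>?I \<times> ?I. (Q p)\<^sup>2) \<le> (1 / c)\<^sup>2"
  proof -
    have q: "(Q (m, n))\<^sup>2 \<le> (1 / (2 * c))\<^sup>2 * (1 / (real m)\<^sup>2 * (1 / (real n)\<^sup>2))"
      if mn: "m \<in> ?I" "n \<in> ?I" for m n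
    proof -
      have "2 * c * (real m * real n) \<le> c * ((real m)\<^sup>2 + (real n)\<^sup>2)"
        using c sum_squares_bound[of "real m" "real n"] by simp
      with scheme_symbol[OF mn] have s: "2 * c * (real m * real n) \<le> \<bar>scheme_symbol h K N m n\<bar>" by linarith
      have "\<bar>sine_mode N i m * sine_mode N j n\<bar> \<le> 1 * 1"
        unfolding abs_mult sine_mode_def by (intro mult_mono) auto
      then have "\<bar>Q (m, n)\<bar> \<le> 1 / (2 * c * (real m * real n))"
        unfolding Q_def using s mn c by (auto simp: abs_mult intro!: frac_le)
      then have "\<bar>Q (m, n)\<bar>\<^sup>2 \<le> (1 / (2 * c * (real m * real n)))\<^sup>2"
        by (intro power_mono) auto
      then show ?thesis by (simp add: power_divide power_mult_distrib)
    qed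
    have "(\<Sum>p\<in>?I \<times> ?I. (Q p)\<^sup>2) = (\<Sum>m\<in>?I. \<Sum>n\<in>?I. (Q (m, n))\<^sup>2)"
      by (simp add: sum.cartesian_product)
    also have "\<dots> \<le> (\<Sum>m\<in>?I. \<Sum>n\<in>?I. (1 / (2 * c))\<^sup>2 * (1 / (real m)\<^sup>2 * (1 / (real n)\<^sup>2)))"
      by (intro sum_mono q)
    also have "\<dots> = (1 / (2 * c))\<^sup>2 * ((\<Sum>m\<in>?I. 1 / (real m)\<^sup>2) * (\<Sum>n\<in>?I. 1 / (real n)\<^sup>2))"
      by (simp only: sum_distrib_left[symmetric] sum_product)
    also have "\<dots> \<le> (1 / (2 * c))\<^sup>2 * (2 * 2)"
      by (intro mult_left_mono mult_mono sum_inverse_squares_le sum_nonneg) auto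
    finally show ?thesis by (simp add: power_divide power_mult_distrib)
  qed
  have "((real N / 2)\<^sup>2 * e i j)\<^sup>2 \<le> (\<Sum>p\<in>?I \<times> ?I. (P p)\<^sup>2) * (\<Sum>p\<in>?I \<times> ?I. (Q p)\<^sup>2)"
    unfolding rep by (rule Cauchy_Schwarz_ineq_sum)
  also have "\<dots> \<le> ((real N / 2)\<^sup>2 * (real N * \<tau>)\<^sup>2) * (1 / c)\<^sup>2"
    by (intro mult_mono P Q) (auto intro: sum_nonneg)
  also have "\<dots> = ((real N / 2)\<^sup>2 * (2 * \<tau> / c))\<^sup>2"
    using N by (simp add: field_simps power2_eq_square)
  finally have "\<bar>(real N / 2)\<^sup>2 * e i j\<bar> \<le> (real N / 2)\<^sup>2 * (2 * \<tau> / c)"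
    using \<tau> c by (subst (asm) abs_le_square_iff[symmetric]) (simp add: abs_mult)
  then have "(real N / 2)\<^sup>2 * \<bar>e i j\<bar> \<le> (real N / 2)\<^sup>2 * (2 * \<tau> / c)"
    by (simp add: abs_mult)
  then show ?thesis by (rule mult_left_le_imp_le) (use N in simp)
qed

section \<open>Uniqueness excludes resonance\<close>

text \<open>
With a free amplitude and free phases the family of products of sines is closed under differentiation, as
cosine is a shifted sine. Smoothness of every order then follows by a plain induction.
\<close>

lemma dx_on_sin_sin:
  assumes "a < b" "p \<in> rect a b c d"
  shows "dx_on (rect a b c d) (\<lambda>(x, y). A * sin (\<omega> * x + \<alpha>) * sin (\<nu> * y + \<beta>)) p
    = (\<lambda>(x, y). (A * \<omega>) * sin (\<omega> * x + (\<alpha> + pi / 2)) * sin (\<nu> * y + \<beta>)) p"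
proof (cases p)
  case (Pair x y)
  have "sin (\<omega> * x + (\<alpha> + pi / 2)) = cos (\<omega> * x + \<alpha>)"
    using sin_add[of "\<omega> * x + \<alpha>" "pi / 2"] by (simp add: add.assoc)
  then have "((\<lambda>s. A * sin (\<omega> * s + \<alpha>) * sin (\<nu> * y + \<beta>)) has_real_derivative
      (A * \<omega>) * sin (\<omega> * x + (\<alpha> + pi / 2)) * sin (\<nu> * y + \<beta>)) (at x within {a..b})"
    by (auto intro!: derivative_eq_intros)
  with assms Pair show ?thesis
    by (auto intro!: dx_on_eqI)
qed

lemma dy_on_sin_sin:
  assumes "c < d" "p \<in> rect a b c d"
  shows "dy_on (rect a b c d) (\<lambda>(x, y). A * sin (\<omega> * x + \<alpha>) * sin (\<nu> * y + \<beta>)) p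
    = (\<lambda>(x, y). (A * \<nu>) * sin (\<omega> * x + \<alpha>) * sin (\<nu> * y + (\<beta> + pi / 2))) p"
proof (cases p)
  case (Pair x y)
  have "sin (\<nu> * y + (\<beta> + pi / 2)) = cos (\<nu> * y + \<beta>)"
    using sin_add[of "\<nu> * y + \<beta>" "pi / 2"] by (simp add: add.assoc)
  then have "((\<lambda>t. A * sin (\<omega> * x + \<alpha>) * sin (\<nu> * t + \<beta>)) has_real_derivative
      (A * \<nu>) * sin (\<omega> * x + \<alpha>) * sin (\<nu> * y + (\<beta> + pi / 2))) (at y within {c..d})"
    by (auto intro!: derivative_eq_intros)
  with assms Pair show ?thesis
    by (auto intro!: dy_on_eqI)
qed

lemma Ck_on_sin_sin:
  assumes "a < b" "c < d"
  shows "Ck_on k (rect a b c d) (\<lambda>(x, y). A * sin (\<omega> * x + \<alpha>) * sin (\<nu> * y + \<beta>))"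
proof (induction k arbitrary: A \<alpha> \<beta>)
  case 0
  show ?case by (auto simp: case_prod_beta intro!: continuous_intros)
next
  case (Suc k)
  let ?S = "rect a b c d" and ?w = "\<lambda>(x, y). A * sin (\<omega> * x + \<alpha>) * sin (\<nu> * y + \<beta>)"
  have "continuous_on ?S ?w" by (auto simp: case_prod_beta intro!: continuous_intros)
  moreover have "Ck_on k ?S (dx_on ?S ?w)" "Ck_on k ?S (dy_on ?S ?w)"
    by (rule Ck_on_cong[OF Suc.IH]; use dx_on_sin_sin[OF assms(1)] in simp; fail)
      (rule Ck_on_cong[OF Suc.IH]; use dy_on_sin_sin[OF assms(2)] in simp; fail)
  moreover have "(\<lambda>s. A * sin (\<omega> * s + \<alpha>) * sin (\<nu> * y + \<beta>)) differentiable (at x within X)"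
    "(\<lambda>t. A * sin (\<omega> * x + \<alpha>) * sin (\<nu> * t + \<beta>)) differentiable (at y within X)" for x y X
    by (rule differentiableI, rule has_field_derivative_imp_has_derivative, auto intro!: derivative_eq_intros)+
  ultimately show ?case by simp
qed

lemma laplace_on_sin_sin:
  fixes A \<omega> \<alpha> \<nu> \<beta> :: real
  assumes "a < b" "c < d" "p \<in> rect a b c d"
  defines "w \<equiv> \<lambda>(x, y). A * sin (\<omega> * x + \<alpha>) * sin (\<nu> * y + \<beta>)"
  shows "laplace_on (rect a b c d) w p = - (\<omega>\<^sup>2 + \<nu>\<^sup>2) * w p"
proof -
  let ?S = "rect a b c d"
  have sin: "sin (z + (pi + e)) = - sin (z + e)" for z e :: real
    using sin_periodic_pi[of "z + e"] by (simp add: add_ac)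
  have "(dx_on ?S ^^ 2) w p
      = dx_on ?S (\<lambda>(x, y). (A * \<omega>) * sin (\<omega> * x + (\<alpha> + pi / 2)) * sin (\<nu> * y + \<beta>)) p"
    unfolding w_def using dx_on_cong[OF dx_on_sin_sin[OF assms(1)] assms(3)]
    by (simp add: numeral_2_eq_2)
  also have "\<dots> = - \<omega>\<^sup>2 * w p"
    unfolding dx_on_sin_sin[OF assms(1,3)] w_def by (simp add: case_prod_beta sin power2_eq_square mult_ac)
  finally have x: "(dx_on ?S ^^ 2) w p = - \<omega>\<^sup>2 * w p" .
  have "(dy_on ?S ^^ 2) w p
      = dy_on ?S (\<lambda>(x, y). (A * \<nu>) * sin (\<omega> * x + \<alpha>) * sin (\<nu> * y + (\<beta> + pi / 2))) p"
    unfolding w_def using dy_on_cong[OF dy_on_sin_sin[OF assms(2)] assms(3)]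
    by (simp add: numeral_2_eq_2)
  also have "\<dots> = - \<nu>\<^sup>2 * w p"
    unfolding dy_on_sin_sin[OF assms(2,3)] w_def by (simp add: case_prod_beta sin power2_eq_square mult_ac)
  finally have y: "(dy_on ?S ^^ 2) w p = - \<nu>\<^sup>2 * w p" .
  from x y show ?thesis by (simp add: laplace_on_def algebra_simps)
qed

lemma laplace_on_add:
  assumes "a < b" "c < d" "Ck_on 2 (rect a b c d) g" "Ck_on 2 (rect a b c d) g'" "p \<in> rect a b c d"
  shows "laplace_on (rect a b c d) (\<lambda>p. g p + g' p) p
    = laplace_on (rect a b c d) g p + laplace_on (rect a b c d) g' p"
proof -
  let ?S = "rect a b c d"
  note dx = dx_on_add[OF assms(1)] and dy = dy_on_add[OF assms(2)]
  have g: "Ck_on (Suc (Suc 0)) ?S g" "Ck_on (Suc (Suc 0)) ?S g'"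
    using assms by (simp_all only: numeral_2_eq_2)
  then have g1: "Ck_on (Suc 0) ?S (dx_on ?S g)" "Ck_on (Suc 0) ?S (dx_on ?S g')"
    "Ck_on (Suc 0) ?S (dy_on ?S g)" "Ck_on (Suc 0) ?S (dy_on ?S g')"
    by (simp_all only: Ck_on.simps(2)[of "Suc 0"])
  have "dx_on ?S (dx_on ?S (\<lambda>p. g p + g' p)) p = dx_on ?S (\<lambda>p. dx_on ?S g p + dx_on ?S g' p) p"
    by (rule dx_on_cong) (use dx[OF g] assms in auto)
  moreover have "dy_on ?S (dy_on ?S (\<lambda>p. g p + g' p)) p = dy_on ?S (\<lambda>p. dy_on ?S g p + dy_on ?S g' p) p"
    by (rule dy_on_cong) (use dy[OF g] assms in auto)
  ultimately show ?thesis
    using dx[OF g1(1,2) assms(5)] dy[OF g1(3,4) assms(5)]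
    by (simp add: laplace_on_def numeral_2_eq_2)
qed

text \<open>
At a resonance the eigenfunction \<open>w\<close>, a product of sines, solves the homogeneous Dirichlet problem,
so \<open>u + w\<close> would be a second solution. It differs from \<open>u\<close> at the first maximum of \<open>w\<close>.
\<close>

lemma unique_imp_nonresonant:
  fixes a b c d K L :: real
  assumes L: "L > 0" "b = a + L" "d = c + L"
    and u: "Ck_on 8 (rect a b c d) u" "dirichlet_solution (rect a b c d) K f \<Phi> u"
    and unique: "\<And>v. Ck_on 8 (rect a b c d) v \<Longrightarrow> dirichlet_solution (rect a b c d) K f \<Phi> v \<Longrightarrow>
      \<forall>p\<in>rect a b c d. v p = u p"
    and mn: "m \<ge> 1" "n \<ge> 1"
  shows "K\<^sup>2 \<noteq> pi\<^sup>2 * ((real m)\<^sup>2 + (real n)\<^sup>2) / L\<^sup>2"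
proof
  assume K: "K\<^sup>2 = pi\<^sup>2 * ((real m)\<^sup>2 + (real n)\<^sup>2) / L\<^sup>2"
  let ?S = "rect a b c d"
  have ab: "a < b" "c < d" using L by auto
  define \<omega> \<nu> where "\<omega> = real m * pi / L" and "\<nu> = real n * pi / L"
  define w where "w = (\<lambda>(x, y). 1 * sin (\<omega> * x + - \<omega> * a) * sin (\<nu> * y + - \<nu> * c))"
  have w: "w (x, y) = sin (\<omega> * (x - a)) * sin (\<nu> * (y - c))" for x y
    by (simp add: w_def algebra_simps)
  have C: "Ck_on k ?S w" for k unfolding w_def by (rule Ck_on_sin_sin[OF ab])
  have lap: "laplace_on ?S w p = - K\<^sup>2 * w p" if "p \<in> ?S" for p
  proof -
    have "laplace_on ?S w p = - (\<omega>\<^sup>2 + \<nu>\<^sup>2) * w p"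
      unfolding w_def by (rule laplace_on_sin_sin[OF ab that])
    also have "\<omega>\<^sup>2 + \<nu>\<^sup>2 = K\<^sup>2"
      unfolding K \<omega>_def \<nu>_def by (simp add: power_divide power_mult_distrib add_divide_distrib algebra_simps)
    finally show ?thesis .
  qed
  have w0: "w p = 0" if "p \<in> frontier ?S" for p
  proof -
    obtain x y where p: "p = (x, y)" by (cases p)
    have "interior ?S = {a<..<b} \<times> {c<..<d}" by (simp add: interior_Times)
    moreover have "closure ?S = ?S" by (simp add: closure_Times)
    ultimately have "x = a \<or> x = b \<or> y = c \<or> y = d"
      using that p unfolding frontier_def by force
    moreover have "\<omega> * (b - a) = real m * pi" "\<nu> * (d - c) = real n * pi"
      using L by (simp_all add: \<omega>_def \<nu>_def)
    ultimately show ?thesis unfolding p w by auto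
  qed
  have lapsum: "laplace_on ?S (\<lambda>p. u p + w p) p = laplace_on ?S u p + laplace_on ?S w p" if "p \<in> ?S" for p
    using laplace_on_add[OF ab Ck_on_mono[OF _ u(1)] C that] by simp
  have "dirichlet_solution ?S K f \<Phi> (\<lambda>p. u p + w p)"
    unfolding dirichlet_solution_def
  proof (intro conjI ballI)
    fix p assume p: "p \<in> interior ?S"
    then have "p \<in> ?S" using interior_subset by blast
    moreover have "laplace_on ?S u p + K\<^sup>2 * u p = f p"
      using u(2) p unfolding dirichlet_solution_def by blast
    ultimately show "laplace_on ?S (\<lambda>p. u p + w p) p + K\<^sup>2 * (u p + w p) = f p"
      by (simp add: lapsum lap distrib_left)
  next
    fix p assume "p \<in> frontier ?S"
    with u(2) w0 show "u p + w p = \<Phi> p" unfolding dirichlet_solution_def by simp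
  qed
  with unique[OF Ck_on_add[OF ab u(1) C]] have zero: "w p = 0" if "p \<in> ?S" for p
    using that by auto
  have "\<omega> * (a + L / (2 * real m) - a) = pi / 2" "\<nu> * (c + L / (2 * real n) - c) = pi / 2"
    using L mn by (simp_all add: \<omega>_def \<nu>_def)
  then have "w (a + L / (2 * real m), c + L / (2 * real n)) = 1" by (simp only: w) simp
  moreover have "L / (2 * real m) \<le> L" "L / (2 * real n) \<le> L"
    using L mn by (simp_all add: divide_le_eq)
  then have "(a + L / (2 * real m), c + L / (2 * real n)) \<in> ?S" using L by auto
  then have "w (a + L / (2 * real m), c + L / (2 * real n)) = 0" by (rule zero)
  ultimately show False by simp
qed

section \<open>A uniform lower bound for the symbol\<close>

lemma sin_ge_chord:
  assumes "0 \<le> t" "t \<le> 1"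
  shows "t \<le> sin (t * (pi / 2))"
proof -
  have "concave_on {0..pi/2} (sin :: real \<Rightarrow> real)"
    by (rule f''_le0_imp_concave[where f' = cos and f'' = "\<lambda>x. - sin x"])
      (auto intro!: derivative_eq_intros sin_ge_zero)
  from concave_onD_Icc[OF this _ assms] show ?thesis by simp
qed

text \<open>
The lower bound is the concavity of the sine on the first quarter period, applied to the angle
\<open>(m / N) (\<pi> / 2)\<close>.
\<close>

lemma diff_eigenvalue_bounds:
  assumes "h > 0" "real N * h = L" "m \<le> N" "N > 0"
  shows "4 * (real m)\<^sup>2 / L\<^sup>2 \<le> diff_eigenvalue h N m" "diff_eigenvalue h N m \<le> 4 / h\<^sup>2"
proof -
  have L: "L > 0" using assms by auto
  have "real m / real N \<le> sin (real m / real N * (pi / 2))"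
    by (rule sin_ge_chord) (use assms in auto)
  then have "(real m / real N)\<^sup>2 \<le> (sin (pi * real m / (2 * real N)))\<^sup>2"
    by (intro power_mono) (auto simp: mult_ac)
  then have "4 * (real m / real N)\<^sup>2 / h\<^sup>2 \<le> diff_eigenvalue h N m"
    unfolding diff_eigenvalue_def by (intro divide_right_mono) auto
  then show "4 * (real m)\<^sup>2 / L\<^sup>2 \<le> diff_eigenvalue h N m"
    unfolding assms(2)[symmetric] by (simp add: power_divide power_mult_distrib)
  have "(sin (pi * real m / (2 * real N)))\<^sup>2 \<le> 1"
    by (simp add: abs_square_le_1)
  then show "diff_eigenvalue h N m \<le> 4 / h\<^sup>2"
    unfolding diff_eigenvalue_def by (intro divide_right_mono) auto
qed

text \<open>
The mixed term has the wrong sign. Since each eigenvalue is at most \<open>4 / h\<^sup>2\<close>, the product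
\<open>h\<^sup>2 p q\<close> is at most \<open>2 (p + q)\<close>, so the mixed term consumes no more than half of \<open>p + q\<close>.
\<close>

lemma scheme_symbol_lower_bound:
  assumes h: "h > 0" "real N * h = L" "m \<le> N" "n \<le> N" "N > 0" and Kh: "K\<^sup>2 * h\<^sup>2 \<le> 15"
  shows "2 * ((real m)\<^sup>2 + (real n)\<^sup>2) / L\<^sup>2 - K\<^sup>2 \<le> scheme_symbol h K N m n"
proof -
  define p q where "p = diff_eigenvalue h N m" and "q = diff_eigenvalue h N n"
  have p: "4 * (real m)\<^sup>2 / L\<^sup>2 \<le> p" "p \<le> 4 / h\<^sup>2" and q: "4 * (real n)\<^sup>2 / L\<^sup>2 \<le> q" "q \<le> 4 / h\<^sup>2"
    unfolding p_def q_def using diff_eigenvalue_bounds h by auto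
  have nn: "0 \<le> p" "0 \<le> q" by (simp_all add: p_def q_def diff_eigenvalue_def)
  have hp: "h\<^sup>2 * p \<le> 4" "h\<^sup>2 * q \<le> 4" using p q h by (simp_all add: field_simps)
  have hpq: "h\<^sup>2 * (p * q) \<le> 2 * (p + q)"
    using mult_right_mono[OF hp(1) nn(2)] mult_right_mono[OF hp(2) nn(1)] by (simp add: algebra_simps)
  have "h^2 / 6 * (1 + K^2 * h^2 / 30) * (p * q) = (1 + K^2 * h^2 / 30) / 6 * (h\<^sup>2 * (p * q))" by simp
  also have "\<dots> \<le> (3 / 2) / 6 * (h\<^sup>2 * (p * q))"
    using Kh nn by (intro mult_right_mono) auto
  also have "\<dots> \<le> (3 / 2) / 6 * (2 * (p + q))"
    using hpq by (intro mult_left_mono) auto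
  finally have 1: "h^2 / 6 * (1 + K^2 * h^2 / 30) * (p * q) \<le> (p + q) / 2" by simp
  have "(1 - K^2 * h^2 / 12 * (1 - K^2 * h^2 / 30)) * K^2 \<le> 1 * K\<^sup>2"
    using Kh by (intro mult_right_mono) auto
  with 1 p q show ?thesis unfolding scheme_symbol_def p_def[symmetric] q_def[symmetric]
    by (simp add: add_divide_distrib distrib_left)
qed

lemma diff_eigenvalue_tendsto:
  assumes "L > 0" "m \<ge> 1"
  shows "(\<lambda>N. diff_eigenvalue (L / real N) N m) \<longlonglongrightarrow> pi\<^sup>2 * (real m)\<^sup>2 / L\<^sup>2"
proof -
  define t where "t = (\<lambda>N. pi * real m / 2 / real N)"
  have "((\<lambda>x::real. sin x / x) \<longlongrightarrow> 1) (at 0)"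
    using DERIV_sin[of "0::real"] by (simp add: DERIV_def)
  moreover have "filterlim t (at 0) sequentially"
    unfolding filterlim_at
  proof
    show "t \<longlonglongrightarrow> 0" unfolding t_def by (rule lim_const_over_n)
    show "\<forall>\<^sub>F N in sequentially. t N \<in> UNIV \<and> t N \<noteq> 0"
      using eventually_gt_at_top[of 0] by eventually_elim (use assms in \<open>auto simp: t_def\<close>)
  qed
  ultimately have "(\<lambda>N. sin (t N) / t N) \<longlonglongrightarrow> 1" by (rule filterlim_compose)
  then have "(\<lambda>N. pi\<^sup>2 * (real m)\<^sup>2 / L\<^sup>2 * (sin (t N) / t N)\<^sup>2) \<longlonglongrightarrow> pi\<^sup>2 * (real m)\<^sup>2 / L\<^sup>2 * 1\<^sup>2"
    by (intro tendsto_intros)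
  moreover have "\<forall>\<^sub>F N in sequentially.
      pi\<^sup>2 * (real m)\<^sup>2 / L\<^sup>2 * (sin (t N) / t N)\<^sup>2 = diff_eigenvalue (L / real N) N m"
    using eventually_gt_at_top[of 0]
    by eventually_elim (use assms in \<open>simp add: t_def diff_eigenvalue_def power_divide power_mult_distrib field_simps\<close>)
  ultimately have "(\<lambda>N. diff_eigenvalue (L / real N) N m) \<longlonglongrightarrow> pi\<^sup>2 * (real m)\<^sup>2 / L\<^sup>2 * 1\<^sup>2"
    by (rule Lim_transform_eventually)
  then show ?thesis by simp
qed

lemma scheme_symbol_tendsto:
  assumes "L > 0" "m \<ge> 1" "n \<ge> 1"
  shows "(\<lambda>N. scheme_symbol (L / real N) K N m n) \<longlonglongrightarrow> pi\<^sup>2 * ((real m)\<^sup>2 + (real n)\<^sup>2) / L\<^sup>2 - K\<^sup>2"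
proof -
  have h: "(\<lambda>N. L / real N) \<longlonglongrightarrow> 0" by (rule lim_const_over_n)
  have "(\<lambda>N. scheme_symbol (L / real N) K N m n) \<longlonglongrightarrow>
    pi\<^sup>2 * (real m)\<^sup>2 / L\<^sup>2 + pi\<^sup>2 * (real n)\<^sup>2 / L\<^sup>2
     - 0^2 / 6 * (1 + K^2 * 0^2 / 30) * (pi\<^sup>2 * (real m)\<^sup>2 / L\<^sup>2 * (pi\<^sup>2 * (real n)\<^sup>2 / L\<^sup>2))
     - (1 - K^2 * 0^2 / 12 * (1 - K^2 * 0^2 / 30)) * K^2"
    unfolding scheme_symbol_def by (intro tendsto_intros h diff_eigenvalue_tendsto assms) auto
  then show ?thesis by (simp add: distrib_left add_divide_distrib)
qed

text \<open>
Only finitely many pairs \<open>(m, n)\<close>, collected in \<open>B\<close>, are not covered by the estimate for high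
frequencies. For each of these the symbol has a nonzero limit \<open>\<Lambda>\<close>, and so has modulus at least half
that of \<open>\<Lambda>\<close> for all large \<open>N\<close>. The constant \<open>\<gamma>\<close> is the least of the resulting finitely many ratios \<open>g\<close> and of
the constant \<open>1 / L\<^sup>2\<close> that serves all other pairs.
\<close>

lemma scheme_symbol_coercive:
  assumes L: "L > 0"
    and nonres: "\<And>m n. m \<ge> 1 \<Longrightarrow> n \<ge> 1 \<Longrightarrow> K\<^sup>2 \<noteq> pi\<^sup>2 * ((real m)\<^sup>2 + (real n)\<^sup>2) / L\<^sup>2"
  shows "\<exists>\<gamma>>0. \<forall>\<^sub>F N in sequentially. \<forall>m\<in>{1..<N}. \<forall>n\<in>{1..<N}.
    \<gamma> * ((real m)\<^sup>2 + (real n)\<^sup>2) \<le> \<bar>scheme_symbol (L / real N) K N m n\<bar>"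
proof -
  define q where "q = (\<lambda>(m, n). (real m)\<^sup>2 + (real n)\<^sup>2)"
  define \<sigma> where "\<sigma> = (\<lambda>(m, n) N. scheme_symbol (L / real N) K N m n)"
  define \<Lambda> where "\<Lambda> = (\<lambda>p. pi\<^sup>2 * q p / L\<^sup>2 - K\<^sup>2)"
  define B where "B = {p \<in> {1..} \<times> {1..}. q p < K\<^sup>2 * L\<^sup>2}"
  have finB: "finite B"
  proof (rule finite_subset)
    have le: "m \<le> nat \<lceil>K\<^sup>2 * L\<^sup>2\<rceil>" if "real m ^ 2 < K\<^sup>2 * L\<^sup>2" for m
    proof -
      have "m \<le> m ^ 2" by (simp add: power2_eq_square)
      then have "real m \<le> real m ^ 2" by (metis of_nat_le_iff of_nat_power)
      with that show ?thesis by linarith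
    qed
    show "B \<subseteq> {..nat \<lceil>K\<^sup>2 * L\<^sup>2\<rceil>} \<times> {..nat \<lceil>K\<^sup>2 * L\<^sup>2\<rceil>}"
      unfolding B_def q_def
      by (auto intro!: le intro: le_less_trans[rotated])
  qed simp
  have qpos: "q p > 0" if "p \<in> {1..} \<times> {1..}" for p
    using that by (auto simp: q_def add_pos_pos)
  define g where "g = (\<lambda>p. \<bar>\<Lambda> p\<bar> / (2 * q p))"
  define \<gamma> where "\<gamma> = Min (insert (1 / L\<^sup>2) (g ` B))"
  have "g p > 0" if "p \<in> B" for p
    using nonres[of "fst p" "snd p"] that qpos[of p] unfolding g_def B_def \<Lambda>_def q_def
    by (auto simp: case_prod_beta)
  then have \<gamma>: "\<gamma> > 0" unfolding \<gamma>_def using finB L by (subst Min_gr_iff) auto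
  have \<gamma>g: "\<gamma> \<le> 1 / L\<^sup>2" "\<And>p. p \<in> B \<Longrightarrow> \<gamma> \<le> g p"
    unfolding \<gamma>_def using finB by (auto intro: Min_le)
  have low: "\<forall>\<^sub>F N in sequentially. \<forall>p\<in>B. \<gamma> * q p \<le> \<bar>\<sigma> p N\<bar>"
  proof (rule eventually_ball_finite[OF finB], rule ballI)
    fix p assume p: "p \<in> B"
    then obtain m n where mn: "p = (m, n)" "m \<ge> 1" "n \<ge> 1" by (auto simp: B_def)
    have q: "q p > 0" using qpos p by (auto simp: B_def)
    have "\<Lambda> p \<noteq> 0" using nonres[of m n] mn by (auto simp: \<Lambda>_def q_def)
    have "(\<lambda>N. \<bar>\<sigma> p N\<bar>) \<longlonglongrightarrow> \<bar>\<Lambda> p\<bar>"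
      unfolding \<sigma>_def \<Lambda>_def q_def mn(1) prod.case by (intro tendsto_rabs scheme_symbol_tendsto L mn)
    then have "\<forall>\<^sub>F N in sequentially. \<bar>\<Lambda> p\<bar> / 2 < \<bar>\<sigma> p N\<bar>"
      by (rule order_tendstoD) (use \<open>\<Lambda> p \<noteq> 0\<close> in simp)
    then show "\<forall>\<^sub>F N in sequentially. \<gamma> * q p \<le> \<bar>\<sigma> p N\<bar>"
    proof eventually_elim
      case (elim N)
      have "\<gamma> * q p \<le> g p * q p" using \<gamma>g(2)[OF p] q by (intro mult_right_mono) auto
      also have "\<dots> = \<bar>\<Lambda> p\<bar> / 2" using q by (simp add: g_def)
      finally show ?case using elim by linarith
    qed
  qed
  have small: "\<forall>\<^sub>F N in sequentially. K\<^sup>2 * (L / real N)\<^sup>2 < 15"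
  proof -
    have "(\<lambda>N. K\<^sup>2 * (L / real N)\<^sup>2) \<longlonglongrightarrow> K\<^sup>2 * 0\<^sup>2" by (intro tendsto_intros lim_const_over_n)
    then show ?thesis by (rule order_tendstoD) simp
  qed
  have "\<forall>\<^sub>F N in sequentially. \<forall>m\<in>{1..<N}. \<forall>n\<in>{1..<N}. \<gamma> * q (m, n) \<le> \<bar>\<sigma> (m, n) N\<bar>"
    using low small eventually_gt_at_top[of 0]
  proof eventually_elim
    case (elim N)
    show ?case
    proof (intro ballI)
      fix m n assume mn: "m \<in> {1..<N}" "n \<in> {1..<N}"
      show "\<gamma> * q (m, n) \<le> \<bar>\<sigma> (m, n) N\<bar>"
      proof (cases "(m, n) \<in> B")
        case True
        with elim show ?thesis by blast
      next
        case False
        with mn have "K\<^sup>2 * L\<^sup>2 \<le> q (m, n)" by (auto simp: B_def)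
        then have K: "K\<^sup>2 \<le> q (m, n) / L\<^sup>2" using L by (simp add: pos_le_divide_eq)
        have "2 * q (m, n) / L\<^sup>2 - K\<^sup>2 \<le> \<sigma> (m, n) N"
          unfolding q_def \<sigma>_def prod.case using elim mn L
          by (intro scheme_symbol_lower_bound) auto
        with K have "1 / L\<^sup>2 * q (m, n) \<le> \<sigma> (m, n) N" by simp
        moreover have "\<gamma> * q (m, n) \<le> 1 / L\<^sup>2 * q (m, n)"
          using \<gamma>g(1) by (intro mult_right_mono) (auto simp: q_def)
        ultimately show ?thesis by linarith
      qed
    qed
  qed
  with \<gamma> show ?thesis by (auto simp: q_def \<sigma>_def)
qed

section \<open>The error estimate\<close>

lemma grid_pt_frontier:
  assumes "h > 0" "a + real N * h = b" "c + real N * h = d" "i \<le> N" "j \<le> N" "i \<in> {0, N} \<or> j \<in> {0, N}"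
  shows "grid_pt a c h i j \<in> frontier (rect a b c d)"
proof -
  have "real k * h \<ge> 0 \<and> real k * h \<le> real N * h" if "k \<le> N" for k
    using that assms(1) by (auto intro!: mult_right_mono)
  from this[OF assms(4)] this[OF assms(5)] have "grid_pt a c h i j \<in> rect a b c d"
    using assms(2,3) by (auto simp: grid_pt_def)
  moreover have "grid_pt a c h i j \<notin> {a<..<b} \<times> {c<..<d}"
    using assms(2,3,6) by (auto simp: grid_pt_def)
  ultimately show ?thesis
    by (auto simp: frontier_def interior_Times closure_Times)
qed

theorem theorem4p7:
  fixes a b c d K :: real and f u \<Phi> :: "real \<times> real \<Rightarrow> real" and \<Omega> :: "(real \<times> real) set"
  assumes "a < b" and "c < d" and "\<Omega> = {a..b} \<times> {c..d}"
    and "Ck_on 6 \<Omega> f"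
    and "Ck_on 8 \<Omega> u"
    and "dirichlet_solution \<Omega> K f \<Phi> u"
    and unique: "\<And>v. Ck_on 8 \<Omega> v \<Longrightarrow> dirichlet_solution \<Omega> K f \<Phi> v \<Longrightarrow> \<forall>p\<in>\<Omega>. v p = u p"
  shows "\<exists>\<epsilon>>0. \<exists>C3\<ge>0. \<exists>C4\<ge>0. \<forall>N h U.
           a + real N * h = b \<and> c + real N * h = d \<and> 0 < K * h \<and> K * h < \<epsilon> \<and>
           scheme_solution a c \<Omega> h N K f \<Phi> U \<longrightarrow>
           grid_error a c h N u U \<le>
             C3 * h ^ 6
             + C4 * (K\<^sup>2 * deriv_norm \<Omega> (grid_interior a c h N) 6 u
                     + deriv_norm \<Omega> (grid_interior a c h N) 8 u) * h ^ 6"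
proof (cases "K > 0 \<and> b - a = d - c")
  case False
  have "K > 0 \<and> b - a = d - c" if "a + real N * h = b" "c + real N * h = d" "0 < K * h" for N h
  proof -
    have "real N * h > 0" using that assms(1) by simp
    then have "h > 0" by (simp add: zero_less_mult_iff)
    with that show ?thesis by (auto simp: zero_less_mult_iff)
  qed
  with False have "\<not> (a + real N * h = b \<and> c + real N * h = d \<and> 0 < K * h)" for N h by blast
  then show ?thesis by (intro exI[of _ 1] conjI) auto
next
  case True
  define L where "L = b - a"
  have L: "L > 0" "b = a + L" "d = c + L" using assms(1) True by (auto simp: L_def)
  have K: "K > 0" using True by simp
  note \<Omega> = assms(3)
  have "K\<^sup>2 \<noteq> pi\<^sup>2 * ((real m)\<^sup>2 + (real n)\<^sup>2) / L\<^sup>2" if "m \<ge> 1" "n \<ge> 1" for m n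
    using unique_imp_nonresonant[OF L assms(5,6)[unfolded \<Omega>] unique[unfolded \<Omega>] that] .
  from scheme_symbol_coercive[OF L(1) this] obtain \<gamma> N0 where \<gamma>: "\<gamma> > 0"
    and coercive: "\<And>N m n. N \<ge> N0 \<Longrightarrow> m \<in> {1..<N} \<Longrightarrow> n \<in> {1..<N} \<Longrightarrow>
      \<gamma> * ((real m)\<^sup>2 + (real n)\<^sup>2) \<le> \<bar>scheme_symbol (L / real N) K N m n\<bar>"
    unfolding eventually_sequentially by blast
  obtain C where C: "C \<ge> 0" and consistent:
    "\<And>N h i j. a + real N * h = b \<Longrightarrow> c + real N * h = d \<Longrightarrow> h > 0 \<Longrightarrow> K\<^sup>2 * h\<^sup>2 \<le> 15 \<Longrightarrow>
      i \<in> {1..<N} \<Longrightarrow> j \<in> {1..<N} \<Longrightarrow>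
      \<bar>scheme_lhs h K (on_grid a c h u) i j - scheme_rhs a c \<Omega> h K f i j\<bar> \<le> C * h ^ 6"
    using scheme_consistency[OF assms(1,2) Ck_on_continuous[OF assms(4)[unfolded \<Omega>]]
        assms(5,6)[unfolded \<Omega>]] unfolding \<Omega> by blast
  \<comment> \<open>the bound on \<open>K * h\<close> has to force \<open>N > N0\<close>, where \<open>h = L / N\<close>, and \<open>K\<^sup>2 h\<^sup>2 \<le> 15\<close>\<close>
  define \<epsilon> where "\<epsilon> = min 1 (K * L / (real N0 + 1))"
  have \<epsilon>: "\<epsilon> > 0" using K L by (simp add: \<epsilon>_def)
  have bound: "grid_error a c h N u U \<le> 2 * C / \<gamma> * h ^ 6"
    if N: "a + real N * h = b" "c + real N * h = d" and Kh: "0 < K * h" "K * h < \<epsilon>"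
      and U: "scheme_solution a c \<Omega> h N K f \<Phi> U" for N h U
  proof -
    have h: "h > 0" using Kh(1) K by (simp add: zero_less_mult_iff)
    have NhL: "real N * h = L" using N L by simp
    then have "real N * h > 0" using L(1) by simp
    then have Npos: "real N > 0" using h by (simp add: zero_less_mult_iff)
    have hL: "h = L / real N" using NhL Npos by (simp add: field_simps)
    have "K * L / real N < K * L / (real N0 + 1)" using Kh(2) by (simp add: \<epsilon>_def hL)
    then have "K * L * (real N0 + 1) < K * L * real N"
      using Npos by (simp add: field_simps)
    then have "real N0 + 1 < real N" using K L(1) by (subst (asm) mult_less_cancel_left_pos) auto
    then have N0: "N0 \<le> N" by simp
    have "(K * h)\<^sup>2 \<le> 1\<^sup>2" using Kh unfolding \<epsilon>_def by (intro power_mono) auto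
    then have Kh15: "K\<^sup>2 * h\<^sup>2 \<le> 15" by (simp add: power_mult_distrib)
    define e where "e = (\<lambda>i j. on_grid a c h u i j - U i j)"
    have e0: "e i j = 0" if "i \<le> N" "j \<le> N" "i \<in> {0, N} \<or> j \<in> {0, N}" for i j
    proof -
      have "u (grid_pt a c h i j) = \<Phi> (grid_pt a c h i j)"
        using grid_pt_frontier[OF h N that] assms(6) unfolding \<Omega> dirichlet_solution_def by blast
      moreover have "U i j = \<Phi> (grid_pt a c h i j)"
        using U that unfolding scheme_solution_def by blast
      ultimately show ?thesis by (simp add: e_def on_grid_def)
    qed
    have residual: "\<bar>scheme_lhs h K e i j\<bar> \<le> C * h ^ 6" if "i \<in> {1..<N}" "j \<in> {1..<N}" for i j
    proof -
      have "scheme_lhs h K U i j = scheme_rhs a c \<Omega> h K f i j"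
        using U that unfolding scheme_solution_def by auto
      then show ?thesis
        using consistent[OF N h Kh15 that] unfolding e_def scheme_lhs_diff by simp
    qed
    have "\<bar>e i j\<bar> \<le> 2 * C / \<gamma> * h ^ 6" if "i \<le> N" "j \<le> N" for i j
    proof (cases "i \<in> {0, N} \<or> j \<in> {0, N}")
      case True
      with e0 that show ?thesis using C \<gamma> h by simp
    next
      case False
      with that have "i \<in> {1..<N}" "j \<in> {1..<N}" by auto
      from discrete_stability[OF \<gamma> coercive[OF N0, folded hL] e0 residual this]
      show ?thesis by simp
    qed
    then show ?thesis
      unfolding grid_error_def by (intro Max.boundedI) (auto simp: e_def on_grid_def)
  qed
  have C3: "0 \<le> 2 * C / \<gamma>" using C \<gamma> by simp
  show ?thesis
  proof (rule exI[of _ \<epsilon>], rule conjI[OF \<epsilon>], rule exI[of _ "2 * C / \<gamma>"], rule conjI[OF C3],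
      rule exI[of _ 0], intro conjI allI impI)
    fix N h U
    assume "a + real N * h = b \<and> c + real N * h = d \<and> 0 < K * h \<and> K * h < \<epsilon> \<and>
      scheme_solution a c \<Omega> h N K f \<Phi> U"
    then show "grid_error a c h N u U \<le> 2 * C / \<gamma> * h ^ 6
      + 0 * (K\<^sup>2 * deriv_norm \<Omega> (grid_interior a c h N) 6 u
             + deriv_norm \<Omega> (grid_interior a c h N) 8 u) * h ^ 6"
      using bound by simp
  qed simp
qed

end
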